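(* Let $n=2m$, $1\le k\le m$, with $k=m$ or $k$ odd, and let $a,b\in\mathbb B^{n-k,k}$ be cup diagrams. Then $S_a\cap S_b\neq\emptyset$ if and only if the following two conditions hold: (I1) every connected component of the circle diagram $\overline{a}b$ contains an even number of dots; (I2) every line segment in $\overline{a}b$ is propagating. Furthermore, if $S_a\cap S_b\ne\emptyset$, then there exists a homeomorphism $S_a\cap S_b\cong(\mathbb S^2)^{\mathrm{circ}}$, where $\mathrm{circ}$ denotes the number of closed connected components of $\overline{a}b$.
   Context: Cup diagrams: take a rectangle in the plane with $m$ vertices labelled $1,\dots,m$ from left to right on its upper horizontal edge. A cup diagram is a non-intersecting diagram inside the rectangle obtained by attaching lower semicircles (cups), each joining two vertices, and vertical line segments (rays), each joining a vertex to the lower horizontal edge, so that every vertex is joined to exactly one endpoint of a cup or ray. In addition, any cup or ray which can be connected to the right edge of the rectangle by a path inside the rectangle not intersecting any other part of the diagram may (but need not) be decorated with a single dot. Diagrams are considered equal if their cups and rays are incident with the same vertices and the dots are distributed in the same way. $\mathbb B^{n-k,k}$ is the set of cup diagrams on $m$ vertices with exactly $\lfloor k/2\rfloor$ cups. Let $\mathbb S^2\subseteq\mathbb R^3$ be the unit sphere, $p=(0,0,1)$, $q=(1,0,0)$. For $a\in\mathbb B^{n-k,k}$, $S_a\subseteq(\mathbb S^2)^m$ is the set of all $(x_1,\dots,x_m)$ with: $x_i=-x_j$ if $i,j$ are connected by an undotted cup; $x_i=x_j$ if $i,j$ are connected by a dotted cup; $x_i=p$ if $i$ is connected to a dotted ray;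 $x_i=-p$ if $i$ is connected to an undotted ray which is the rightmost ray of $a$; $x_i=q$ if $i$ is connected to an undotted ray which is not the rightmost ray of $a$. Circle diagram: $\overline{a}b$ is obtained by reflecting $a$ in the horizontal middle line of the rectangle and gluing the result (denoted $\overline a$) on top of $b$, identifying the vertices of $\overline a$ and $b$ pairwise from left to right (dots are kept). Each connected component of $\overline ab$ is either closed (no endpoints) or a line segment. A line segment is called propagating if it contains a ray of $a$ and a ray of $b$. *)

theory Defs
  imports "HOL-Analysis.Analysis"
begin

section \<open>Cup diagrams\<close>

text \<open>
  A diagram is recorded by its strands (with the vertices they are incident with) and by the set
  of strands carrying a dot, so that two diagrams are equal exactly when their cups and rays join
  the same vertices and their dots are distributed in the same way. Planarity and the condition on
  dots are imposed on the picture drawn by these strands in the plane, which is identified with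
  the complex numbers; vertex i is the point i of the real axis.
\<close>

datatype strand = Cup nat nat | Ray nat

fun ends :: "strand \<Rightarrow> nat set" where
  "ends (Cup i j) = {i, j}"
| "ends (Ray i) = {i}"

record diagram =
  strands :: "strand set"
  dotted :: "strand set"

text \<open>
  The height m of the rectangle exceeds the radius (at most (m - 1) / 2) of every semicircle
  joining two of the m vertices, so cups stay away from the lower edge.
\<close>

definition rectangle :: "nat \<Rightarrow> complex set" where
  "rectangle m = cbox (Complex 0 (- real m)) (Complex (real m + 1) 0)"

fun curve :: "nat \<Rightarrow> strand \<Rightarrow> complex set" where
  "curve m (Cup i j) =
     {z \<in> sphere (Complex ((real i + real j) / 2) 0) ((real j - real i) / 2). Im z \<le> 0}"
| "curve m (Ray i) = closed_segment (Complex (real i) 0) (Complex (real i) (- real m))"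

definition picture :: "nat \<Rightarrow> diagram \<Rightarrow> complex set" where
  "picture m d = (\<Union>s\<in>strands d. curve m s)"

definition accessible :: "nat \<Rightarrow> strand set \<Rightarrow> strand \<Rightarrow> bool" where
  "accessible m A s \<longleftrightarrow>
     (\<exists>g. path g \<and> path_image g \<subseteq> rectangle m \<and>
          pathstart g \<in> curve m s \<and> Re (pathfinish g) = real m + 1 \<and>
          path_image g \<inter> (\<Union>t\<in>A - {s}. curve m t) = {})"

definition cup_diagram :: "nat \<Rightarrow> diagram \<Rightarrow> bool" where
  "cup_diagram m d \<longleftrightarrow>
     (\<forall>s\<in>strands d. ends s \<subseteq> {1..m}) \<and>
     (\<forall>i j. Cup i j \<in> strands d \<longrightarrow> i < j) \<and>
     (\<forall>v\<in>{1..m}. \<exists>!s. s \<in> strands d \<and> v \<in> ends s) \<and>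
     pairwise (\<lambda>s t. disjnt (curve m s) (curve m t)) (strands d) \<and>
     dotted d \<subseteq> strands d \<and>
     (\<forall>s\<in>dotted d. accessible m (strands d) s)"

text \<open>
  The set of diagrams attached to a two-row partition (p, q) of n = 2m: they have m vertices and
  exactly q div 2 cups.
\<close>

definition cup_diagrams :: "nat \<Rightarrow> nat \<Rightarrow> diagram set" where
  "cup_diagrams p q =
     {d. cup_diagram ((p + q) div 2) d \<and> card {(i, j). Cup i j \<in> strands d} = q div 2}"


section \<open>The subspaces of a power of the sphere\<close>

abbreviation sphere2 :: "(real ^ 3) set" where
  "sphere2 \<equiv> sphere 0 1"

definition pole_p :: "real ^ 3" where
  "pole_p = vector [0, 0, 1]"

definition point_q :: "real ^ 3" where
  "point_q = vector [1, 0, 0]"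

text \<open>
  Points of a power of the sphere are functions that are undefined outside the index set, as in
  the carrier of the product topology.
\<close>

definition sphere_power :: "nat set \<Rightarrow> (nat \<Rightarrow> real ^ 3) topology" where
  "sphere_power I = product_topology (\<lambda>_. top_of_set sphere2) I"

definition rightmost_ray :: "diagram \<Rightarrow> nat \<Rightarrow> bool" where
  "rightmost_ray d i \<longleftrightarrow> Ray i \<in> strands d \<and> (\<forall>j. Ray j \<in> strands d \<longrightarrow> j \<le> i)"

definition S_space :: "nat \<Rightarrow> diagram \<Rightarrow> (nat \<Rightarrow> real ^ 3) set" where
  "S_space m d =
     {x \<in> topspace (sphere_power {1..m}).
        (\<forall>i j. Cup i j \<in> strands d \<and> Cup i j \<notin> dotted d \<longrightarrow> x i = - x j) \<and>
        (\<forall>i j. Cup i j \<in> strands d \<and> Cup i j \<in> dotted d \<longrightarrow> x i = x j) \<and>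
        (\<forall>i. Ray i \<in> strands d \<and> Ray i \<in> dotted d \<longrightarrow> x i = pole_p) \<and>
        (\<forall>i. Ray i \<in> strands d \<and> Ray i \<notin> dotted d \<and> rightmost_ray d i \<longrightarrow> x i = - pole_p) \<and>
        (\<forall>i. Ray i \<in> strands d \<and> Ray i \<notin> dotted d \<and> \<not> rightmost_ray d i \<longrightarrow> x i = point_q)}"


section \<open>Circle diagrams\<close>

text \<open>
  All vertices lie on the real axis. Reflecting the first diagram in the middle line of its
  rectangle and gluing the result on top of the second one is therefore the same as reflecting it
  in the real axis, that is, applying complex conjugation.
\<close>

definition circle_diagram :: "nat \<Rightarrow> diagram \<Rightarrow> diagram \<Rightarrow> complex set" where
  "circle_diagram m a b = cnj ` picture m a \<union> picture m b"

text \<open>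
  The endpoints of a component are the points where rays meet the two horizontal edges of the
  glued rectangle.
\<close>

definition closed_component :: "nat \<Rightarrow> complex set \<Rightarrow> bool" where
  "closed_component m C \<longleftrightarrow> (\<forall>z\<in>C. \<bar>Im z\<bar> \<noteq> real m)"

definition num_dots :: "nat \<Rightarrow> diagram \<Rightarrow> diagram \<Rightarrow> complex set \<Rightarrow> nat" where
  "num_dots m a b C =
     card {s \<in> dotted a. cnj ` curve m s \<subseteq> C} + card {s \<in> dotted b. curve m s \<subseteq> C}"

definition propagating :: "nat \<Rightarrow> diagram \<Rightarrow> diagram \<Rightarrow> complex set \<Rightarrow> bool" where
  "propagating m a b C \<longleftrightarrow>
     (\<exists>i. Ray i \<in> strands a \<and> cnj ` curve m (Ray i) \<subseteq> C) \<and>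
     (\<exists>i. Ray i \<in> strands b \<and> curve m (Ray i) \<subseteq> C)"

definition circ :: "nat \<Rightarrow> diagram \<Rightarrow> diagram \<Rightarrow> nat" where
  "circ m a b = card {C \<in> components (circle_diagram m a b). closed_component m C}"

end

theory Submission
  imports Defs
begin

text \<open>
  Each diagram defines an involution of the vertices whose fixed points are the rays, and the
  components of the circle diagram are the orbits of the two involutions. On an orbit, a point of
  both subspaces is determined up to signs by one of its coordinates; multiplying all these signs
  gives the parity condition on dots. An orbit with a fixed point has exactly two, which makes
  components lines or circles. Since the values at the rays of one diagram are q except at the
  rightmost ray, where they are p or -p, the line at the rightmost ray must propagate to the
  rightmost ray of the other diagram; a parity version of the Jordan curve theorem shows that the
  lines to the left of it carry no dots, hence must propagate as well.
\<close>

section \<open>Orbits of a pair of involutions\<close>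

text \<open>The parity conditions come from a double count: the product of a signing over an orbit
  is computed once by grouping the vertices into cups of \<open>a\<close> and once into cups of
  \<open>b\<close>, each undotted cup contributing -1. For either diagram the orbit has 2 * cups +
  ends vertices. Equally many ends in both make the numbers of cups equal, so that only dots remain.
  If both ends of a line belonged to the same diagram, the numbers of cups would differ by one, an
  odd number of sign changes; without dots this contradicts the equal value q at both ends, as q is
  not -q. This is why undotted lines propagate.

  The product identity is only a necessary condition. Existence of signs on a line rests on counting
  fixed points in a double cover.

  Planarity enters through explicit intersection points of semicircles and rays, and through the
  intermediate value theorem along the paths that make dots accessible. Afterwards it is used as
  order relations between vertices and parity counts in intervals.\<close>

inductive_set orbit2 :: "('a \<Rightarrow> 'a) \<Rightarrow> ('a \<Rightarrow> 'a) \<Rightarrow> 'a \<Rightarrow> 'a set" for f g x where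
  base [intro, simp]: "x \<in> orbit2 f g x"
| left [intro]: "y \<in> orbit2 f g x \<Longrightarrow> f y \<in> orbit2 f g x"
| right [intro]: "y \<in> orbit2 f g x \<Longrightarrow> g y \<in> orbit2 f g x"

lemma orbit2_trans: "z \<in> orbit2 f g x" if "z \<in> orbit2 f g y" "y \<in> orbit2 f g x"
  using that by (induction rule: orbit2.induct) auto

lemma orbit2_least: "orbit2 f g x \<subseteq> A" if "x \<in> A" "f ` A \<subseteq> A" "g ` A \<subseteq> A"
proof
  show "y \<in> A" if "y \<in> orbit2 f g x" for y
    using that by induction (use \<open>x \<in> A\<close> \<open>f ` A \<subseteq> A\<close> \<open>g ` A \<subseteq> A\<close> in auto)
qed

lemma orbit2_commute: "orbit2 f g x = orbit2 g f x"
  by (intro equalityI orbit2_least) auto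

context
  fixes f g :: "'a \<Rightarrow> 'a"
  assumes ff: "\<And>x. f (f x) = x" and gg: "\<And>x. g (g x) = x"
begin

text \<open>An involution undoes its own move by a further forward move, so closing under
  \<open>f\<close> and \<open>g\<close> alone already gives the orbits of the group they
  generate.\<close>

lemma orbit2_sym: "y \<in> orbit2 f g x \<Longrightarrow> x \<in> orbit2 f g y"
proof (induction rule: orbit2.induct)
  case (left y)
  show ?case by (rule orbit2_trans [OF left.IH]) (metis ff orbit2.base orbit2.left)
next
  case (right y)
  show ?case by (rule orbit2_trans [OF right.IH]) (metis gg orbit2.base orbit2.right)
qed simp

lemma orbit2_eq: "y \<in> orbit2 f g x \<Longrightarrow> orbit2 f g y = orbit2 f g x"
  using orbit2_sym orbit2_trans by (metis subsetI subset_antisym)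

text \<open>
  If r is an f-fixed point, its orbit is a cycle of p = f o g of some length N, on which f acts as
  t \<mapsto> N - t and g as t \<mapsto> N - 1 - t.
\<close>
lemma card_fixed_points_orbit2:
  assumes r: "f r = r" and fin: "finite (orbit2 f g r)"
  shows "card {v \<in> orbit2 f g r. f v = v} + card {v \<in> orbit2 f g r. g v = v} = 2"
proof -
  define p where "p = f \<circ> g"
  let ?w = "\<lambda>t. (p ^^ t) r"
  let ?K = "orbit2 f g r"
  have inj: "inj (p ^^ t)" for t
  proof -
    have "inj p" unfolding p_def inj_def by (metis comp_apply ff gg)
    then show ?thesis by (induction t) (auto intro: inj_compose)
  qed
  have split: "?w t = (p ^^ s) (?w (t - s))" if "s \<le> t" for s t
    using funpow_add[of s "t - s" p] that by simp
  have p_sub: "?w t \<in> ?K" for t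
    by (induction t) (auto simp: p_def)
  have "\<not> inj ?w"
    using fin p_sub finite_subset[of "range ?w" ?K] finite_imageD infinite_UNIV_nat by blast
  then obtain s t where "s < t" "?w s = ?w t"
    unfolding inj_def by (metis linorder_neqE_nat)
  then have "(p ^^ s) r = (p ^^ s) (?w (t - s))"
    using split[of s t] by simp
  then have ex: "t - s > 0 \<and> ?w (t - s) = r"
    using injD[OF inj] \<open>s < t\<close> by (metis zero_less_diff)
  define N where "N = (LEAST n. n > 0 \<and> ?w n = r)"
  have N: "N > 0" "?w N = r" using LeastI[of "\<lambda>n. n > 0 \<and> ?w n = r", OF ex] by (auto simp: N_def)
  have N_least: "?w n \<noteq> r" if "0 < n" "n < N" for n
    using not_less_Least[of n "\<lambda>n. n > 0 \<and> ?w n = r"] that by (auto simp: N_def)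
  have w_inj: "inj_on ?w {..<N}"
  proof (rule linorder_inj_onI)
    fix s t assume st: "s < t" "s \<in> {..<N}" "t \<in> {..<N}"
    show "?w s \<noteq> ?w t"
    proof
      assume "?w s = ?w t"
      then have "(p ^^ s) r = (p ^^ s) (?w (t - s))"
        using split[of s t] st by simp
      then show False
        using injD[OF inj[of s]] N_least[of "t - s"] st
        by (metis diff_less_mono2 lessThan_iff less_imp_diff_less zero_less_diff)
    qed
  qed auto
  \<comment> \<open>Dihedral relations: \<open>p \<circ> f \<circ> p = f\<close>, and likewise for
    \<open>g\<close>, because both maps are involutions. They turn \<open>f\<close> and
    \<open>g\<close> into reflections of the index on the cycle.\<close>
  have pfp: "(p ^^ t) (f ((p ^^ t) x)) = f x" for t x
    by (induction t arbitrary: x) (simp, simp add: funpow_swap1 p_def ff gg)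
  have pgp: "(p ^^ t) (g ((p ^^ t) x)) = g x" for t x
    by (induction t arbitrary: x) (simp, simp add: funpow_swap1 p_def ff gg)
  have fw: "f (?w t) = ?w (N - t)" if "t < N" for t
  proof -
    have "(p ^^ t) (f (?w t)) = (p ^^ t) (?w (N - t))"
      using pfp[of t r] split[of t N] that N(2) r by simp
    then show ?thesis by (rule injD[OF inj])
  qed
  have gw: "g (?w t) = ?w (N - 1 - t)" if "t < N" for t
  proof -
    have "(p ^^ Suc t) (g (?w t)) = p (g r)" using pgp[of t r] by simp
    also have "\<dots> = ?w N" by (simp add: p_def gg r N(2)[unfolded p_def])
    also have "\<dots> = (p ^^ Suc t) (?w (N - 1 - t))"
      using split[of "Suc t" N] that by simp
    finally show ?thesis by (rule injD[OF inj])
  qed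
  have K: "?K = ?w ` {..<N}"
  proof
    have r_in: "r \<in> ?w ` {..<N}" by (rule image_eqI[of _ _ 0]) (use N in auto)
    have "f (?w t) \<in> ?w ` {..<N}" if "t < N" for t
      using fw[OF that] N that r_in by (cases "t = 0") (auto simp: r)
    moreover have "g (?w t) \<in> ?w ` {..<N}" if "t < N" for t
      using gw[OF that] N that by auto
    ultimately show "?K \<subseteq> ?w ` {..<N}" using r_in by (intro orbit2_least) auto
  qed (use p_sub in auto)
  have f_fix: "f (?w t) = ?w t \<longleftrightarrow> t = 0 \<or> 2 * t = N" if "t < N" for t
  proof (cases "t = 0")
    case False
    then have "?w (N - t) = ?w t \<longleftrightarrow> N - t = t"
      using w_inj that by (auto simp: inj_on_def)
    then show ?thesis using that fw False by auto
  qed (simp add: r)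
  have g_fix: "g (?w t) = ?w t \<longleftrightarrow> 2 * t + 1 = N" if "t < N" for t
  proof -
    have "?w (N - 1 - t) = ?w t \<longleftrightarrow> N - 1 - t = t"
      using w_inj that by (auto simp: inj_on_def)
    then show ?thesis using that gw by auto
  qed
  have 1: "{v \<in> ?K. f v = v} = ?w ` {t. t < N \<and> (t = 0 \<or> 2 * t = N)}"
    unfolding K using f_fix by auto
  have 2: "{v \<in> ?K. g v = v} = ?w ` {t. t < N \<and> 2 * t + 1 = N}"
    unfolding K using g_fix by auto
  have 3: "card {v \<in> ?K. f v = v} = card {t. t < N \<and> (t = 0 \<or> 2 * t = N)}"
    unfolding 1 by (intro card_image inj_on_subset[OF w_inj]) auto
  have 4: "card {v \<in> ?K. g v = v} = card {t. t < N \<and> 2 * t + 1 = N}"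
    unfolding 2 by (intro card_image inj_on_subset[OF w_inj]) auto
  \<comment> \<open>\<open>f\<close> fixes index 0, and index N/2 when \<open>N\<close> is even;
    \<open>g\<close> fixes index (N-1)/2 when \<open>N\<close> is odd. For \<open>N = 1\<close> the
    single vertex is fixed by both and counted twice.\<close>
  show ?thesis
  proof (cases "even N")
    case True
    then obtain h where h: "N = 2 * h" by blast
    have "{t. t < N \<and> (t = 0 \<or> 2 * t = N)} = {0, h}" "{t. t < N \<and> 2 * t + 1 = N} = {}"
      using h N by (auto, presburger)
    then show ?thesis using 3 4 h N by simp
  next
    case False
    then obtain h where h: "N = 2 * h + 1" using oddE by blast
    have "{t. t < N \<and> (t = 0 \<or> 2 * t = N)} = {0}" "{t. t < N \<and> 2 * t + 1 = N} = {h}"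
      using h N by (auto, presburger)
    then show ?thesis using 3 4 by simp
  qed
qed

end

section \<open>Signings of an orbit\<close>

text \<open>\<open>e\<close> is a sign on the edges of \<open>f\<close>, stored at both ends. The
  value 1 at fixed points keeps both lifts of a fixed vertex fixed when \<open>f\<close> acts on
  vertices with a sign. The conditions are global, so that the lifted map is an involution of the
  whole type.\<close>

definition sign_change :: "('a \<Rightarrow> 'a) \<Rightarrow> ('a \<Rightarrow> real) \<Rightarrow> bool" where
  "sign_change f e \<longleftrightarrow>
     (\<forall>v. f (f v) = v \<and> e v \<in> {1, -1} \<and> e (f v) = e v \<and> (f v = v \<longrightarrow> e v = 1))"

text \<open>A section over \<open>K\<close> of the double cover determined by the edge signs
  \<open>e\<close> of \<open>f\<close> and \<open>h\<close> of \<open>g\<close>.\<close>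

definition signing :: "('a \<Rightarrow> 'a) \<Rightarrow> ('a \<Rightarrow> real) \<Rightarrow> ('a \<Rightarrow> 'a) \<Rightarrow> ('a \<Rightarrow> real) \<Rightarrow> 'a set \<Rightarrow> ('a \<Rightarrow> real) \<Rightarrow> bool" where
  "signing f e g h K s \<longleftrightarrow>
     (\<forall>v\<in>K. s v \<in> {1, -1} \<and> s (f v) = e v * s v \<and> s (g v) = h v * s v)"

lemma sign_changeD:
  assumes "sign_change f e"
  shows "f (f v) = v" "e v \<in> {1, -1}" "e (f v) = e v" "f v = v \<Longrightarrow> e v = 1" "e v * (e v * t) = t"
    "e v * e v = 1"
  using assms unfolding sign_change_def by (auto, (metis mult_1 mult_minus_left minus_minus)+)

text \<open>
  Passing to the double cover, whose vertices carry a sign: if the orbit lifted to a connected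
  cover, the lift would have four fixed points instead of two.
\<close>
lemma signing_exists_of_fixed_point:
  assumes f: "sign_change f e" and g: "sign_change g h"
    and r: "f r = r" and fin: "finite (orbit2 f g r)"
  shows "\<exists>s. signing f e g h (orbit2 f g r) s"
proof -
  let ?K = "orbit2 f g r"
  define F where "F = (\<lambda>(v, s). (f v, e v * s))"
  define G where "G = (\<lambda>(v, s). (g v, h v * s))"
  note fD = sign_changeD[OF f] and gD = sign_changeD[OF g]
  have FF: "F (F x) = x" and GG: "G (G x) = x" for x
    by (cases x; simp add: F_def G_def fD gD)+
  let ?L = "orbit2 F G (r, 1)"
  have L_sub: "?L \<subseteq> ?K \<times> {1, -1}"
  proof (rule orbit2_least)
    show "F ` (?K \<times> {1, -1}) \<subseteq> ?K \<times> {1, -1}" "G ` (?K \<times> {1, -1}) \<subseteq> ?K \<times> {1, -1}"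
      using fD(2) gD(2) by (fastforce simp: F_def G_def)+
  qed auto
  then have fin_L: "finite ?L" using fin by (meson finite.intros finite_SigmaI finite_subset)
  have onto: "\<exists>s. (v, s) \<in> ?L" if "v \<in> ?K" for v
    using that
  proof induction
    case (left y)
    then obtain s where "(y, s) \<in> ?L" by blast
    then have "F (y, s) \<in> ?L" by (rule orbit2.left)
    then show ?case by (auto simp: F_def)
  next
    case (right y)
    then obtain s where "(y, s) \<in> ?L" by blast
    then have "G (y, s) \<in> ?L" by (rule orbit2.right)
    then show ?case by (auto simp: G_def)
  qed auto
  \<comment> \<open>Negating the sign commutes with \<open>F\<close> and \<open>G\<close>, so it
    carries the lifted orbit of \<open>(r, 1)\<close> to that of \<open>(r, -1)\<close>.\<close>
  have deck: "(fst x, - snd x) \<in> orbit2 F G (r, -1)" if "x \<in> ?L" for x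
    using that
  proof induction
    case (left y)
    then have "F (fst y, - snd y) \<in> orbit2 F G (r, -1)" by (intro orbit2.left)
    also have "F (fst y, - snd y) = (fst (F y), - snd (F y))" by (simp add: F_def split_beta)
    finally show ?case .
  next
    case (right y)
    then have "G (fst y, - snd y) \<in> orbit2 F G (r, -1)" by (intro orbit2.right)
    also have "G (fst y, - snd y) = (fst (G y), - snd (G y))" by (simp add: G_def split_beta)
    finally show ?case .
  qed auto
  \<comment> \<open>If both signs occur over one vertex, the two lifted orbits coincide and contain
    both lifts of every vertex. The fixed points are then doubled, against the count of two.\<close>
  have unique: False if "(v, 1) \<in> ?L" "(v, -1) \<in> ?L" for v
  proof -
    have "(v, -1) \<in> orbit2 F G (r, -1)" using deck[OF that(1)] by simp
    then have eq: "orbit2 F G (r, -1) = ?L"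
      using orbit2_eq[of F G] FF GG that(2) by metis
    have "?K \<times> {1, -1} \<subseteq> ?L"
    proof clarify
      fix v s assume v: "v \<in> ?K" "s \<in> {1, -1::real}"
      obtain t where t: "(v, t) \<in> ?L" using onto v by blast
      then have "(v, -t) \<in> ?L" using deck eq by fastforce
      moreover have "t \<in> {1, -1}" using t L_sub by auto
      ultimately show "(v, s) \<in> ?L" using v t by auto
    qed
    with L_sub have L: "?L = ?K \<times> {1, -1}" by blast
    have "{x \<in> ?L. F x = x} = {v \<in> ?K. f v = v} \<times> {1, -1}"
      unfolding L by (auto simp: F_def fD(4))
    moreover have "{x \<in> ?L. G x = x} = {v \<in> ?K. g v = v} \<times> {1, -1}"
      unfolding L by (auto simp: G_def gD(4))
    moreover have "F (r, 1) = (r, 1)" by (simp add: F_def r fD(4))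
    ultimately show False
      using card_fixed_points_orbit2[of F G "(r, 1)", OF FF GG _ fin_L]
        card_fixed_points_orbit2[of f g r, OF fD(1) gD(1) r fin]
      by (simp add: card_cartesian_product)
  qed
  define s where "s v = (if (v, 1) \<in> ?L then 1 else - 1 :: real)" for v
  have s_in: "(v, s v) \<in> ?L" if v: "v \<in> ?K" for v
    using onto[OF v] L_sub by (auto simp: s_def)
  have s_eq: "t = s v" if "(v, t) \<in> ?L" for v t
    using that L_sub unique by (auto simp: s_def)
  have "s (f v) = e v * s v \<and> s (g v) = h v * s v" if v: "v \<in> ?K" for v
  proof -
    have "F (v, s v) \<in> ?L" "G (v, s v) \<in> ?L" using s_in[OF v] by auto
    then show ?thesis using s_eq by (auto simp: F_def G_def)
  qed
  then show ?thesis by (intro exI[of _ s]) (auto simp: signing_def s_def)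
qed

section \<open>Products over the pairs of an involution\<close>

lemma prod_involution:
  fixes f :: "'a :: linorder \<Rightarrow> 'a" and s :: "'a \<Rightarrow> 'b :: comm_monoid_mult"
  assumes ff: "\<And>v. f (f v) = v" and K: "f ` K \<subseteq> K" and fin: "finite K"
  shows "prod s K = (\<Prod>v\<in>{v \<in> K. v < f v}. s v * s (f v)) * prod s {v \<in> K. f v = v}"
proof -
  let ?A = "{v \<in> K. v < f v}"
  have K_eq: "K = (?A \<union> f ` ?A) \<union> {v \<in> K. f v = v}"
  proof -
    have "v \<in> f ` ?A" if "v \<in> K" "f v < v" for v
      by (rule image_eqI[of _ _ "f v"]) (use that ff K in auto)
    then show ?thesis using K by (auto; metis linorder_neqE)
  qed
  have "prod s K = prod s (?A \<union> f ` ?A) * prod s {v \<in> K. f v = v}"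
    by (subst K_eq, rule prod.union_disjoint) (use fin ff in auto)
  also have "prod s (?A \<union> f ` ?A) = prod s ?A * prod s (f ` ?A)"
    by (rule prod.union_disjoint) (use fin ff in auto)
  also have "prod s (f ` ?A) = prod (\<lambda>v. s (f v)) ?A"
    by (rule prod.reindex_cong[of f]) (auto intro: inj_on_inverseI[of _ f] simp: ff)
  finally show ?thesis by (simp add: prod.distrib)
qed

text \<open>Applied to the constant 2, \<open>prod_involution\<close> becomes an identity of powers
  of two, whose exponents can be compared.\<close>

lemma card_involution:
  fixes f :: "'a :: linorder \<Rightarrow> 'a"
  assumes "\<And>v. f (f v) = v" "f ` K \<subseteq> K" "finite K"
  shows "card K = 2 * card {v \<in> K. v < f v} + card {v \<in> K. f v = v}"
proof -
  have "(2::nat) ^ card K = 2 ^ (2 * card {v \<in> K. v < f v} + card {v \<in> K. f v = v})"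
    using prod_involution[OF assms, of "\<lambda>_. 2::nat"] by (simp add: power_add power_mult)
  then show ?thesis by simp
qed

text \<open>The linear order picks one end of each edge, so that every edge contributes its sign
  once.\<close>

definition total_sign :: "('a :: linorder \<Rightarrow> 'a) \<Rightarrow> ('a \<Rightarrow> real) \<Rightarrow> 'a set \<Rightarrow> real" where
  "total_sign f e K = prod e {v \<in> K. v < f v}"

text \<open>Since signs square to 1, the two values of \<open>s\<close> on an edge multiply to the
  sign of that edge; the fixed points contribute their own values.\<close>

lemma total_sign_signing:
  assumes f: "sign_change f e" and s: "signing f e g h K s" and K: "f ` K \<subseteq> K" "finite K"
  shows "prod s K = total_sign f e K * prod s {v \<in> K. f v = v}"
proof -
  have "s v * s (f v) = e v" if "v \<in> K" for v
    using s that by (auto simp: signing_def)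
  then show ?thesis
    using prod_involution[OF sign_changeD(1)[OF f] K, of s] by (simp add: total_sign_def)
qed

lemma signing_commute: "signing f e g h K s \<longleftrightarrow> signing g h f e K s"
  by (auto simp: signing_def)

lemma prod_signs: "prod s A \<in> {1, -1}" if "\<And>v. v \<in> A \<Longrightarrow> s v \<in> {1, -1 :: real}"
  using that by (induction A rule: infinite_finite_induct) fastforce+

text \<open>
  Cutting a cycle at one edge gives a line, which has a signing; the total sign decides whether
  the signing is compatible with the removed edge.
\<close>
lemma signing_exists_of_total_sign:
  fixes f g :: "'a :: linorder \<Rightarrow> 'a"
  assumes f: "sign_change f e" and g: "sign_change g h"
    and fin: "finite (orbit2 f g x)"
    and no_fix: "\<And>v. v \<in> orbit2 f g x \<Longrightarrow> f v \<noteq> v \<and> g v \<noteq> v"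
    and total: "total_sign f e (orbit2 f g x) = total_sign g h (orbit2 f g x)"
  shows "\<exists>s. signing f e g h (orbit2 f g x) s"
proof -
  let ?K = "orbit2 f g x"
  note fD = sign_changeD[OF f] and gD = sign_changeD[OF g]
  have fx: "f x \<noteq> x" "f x \<in> ?K" using no_fix by auto
  \<comment> \<open>\<open>f'\<close> forgets the edge between \<open>x\<close> and
    \<open>f x\<close>, which turns both ends into fixed points; \<open>e'\<close> must then be 1
    there.\<close>
  define f' where "f' v = (if v \<in> {x, f x} then v else f v)" for v
  define e' where "e' v = (if v \<in> {x, f x} then 1 else e v)" for v
  have f': "sign_change f' e'"
    unfolding sign_change_def f'_def e'_def using fD(1-4)
    by (auto split: if_splits) metis+
  let ?L = "orbit2 f' g x"
  have L_sub: "?L \<subseteq> ?K" by (rule orbit2_least) (auto simp: f'_def)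
  have fin_L: "finite ?L" using L_sub fin finite_subset by blast
  have "f' x = x" by (simp add: f'_def)
  note card = card_fixed_points_orbit2[OF sign_changeD(1)[OF f'] gD(1) this fin_L]
  have no_fix_g: "{v \<in> ?L. g v = v} = {}" using no_fix L_sub by auto
  \<comment> \<open>No vertex is fixed by \<open>g\<close>, so the count of two forces both ends of
    the removed edge into the cut orbit: removing one edge does not disconnect a cycle.\<close>
  have card2: "card {v \<in> ?L. f' v = v} = 2" using card unfolding no_fix_g by simp
  have "{v \<in> ?L. f' v = v} \<subseteq> {x, f x}" using no_fix L_sub by (auto simp: f'_def split: if_splits)
  then have fix_L: "{v \<in> ?L. f' v = v} = {x, f x}"
    using card2 fx by (intro card_subset_eq) auto
  have L: "?L = ?K"
  proof
    have "f v \<in> ?L" if "v \<in> ?L" for v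
    proof (cases "v \<in> {x, f x}")
      case True
      then show ?thesis using fix_L fD(1) by auto
    next
      case False
      then show ?thesis using orbit2.left[OF that] by (simp add: f'_def)
    qed
    then show "?K \<subseteq> ?L" by (intro orbit2_least) auto
  qed (rule L_sub)
  obtain s where s: "signing f' e' g h ?K s"
    using signing_exists_of_fixed_point[OF f' g \<open>f' x = x\<close> fin_L] L by auto
  have s1: "s v \<in> {1, -1}" if "v \<in> ?K" for v using s that by (auto simp: signing_def)
  have K': "f' ` ?K \<subseteq> ?K" "g ` ?K \<subseteq> ?K" "f ` ?K \<subseteq> ?K" by (auto simp: f'_def)
  have "prod s ?K = total_sign f' e' ?K * (s x * s (f x))"
    using total_sign_signing[OF f' s K'(1) fin] fix_L fx by (simp add: L)
  moreover have "prod s ?K = total_sign g h ?K"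
  proof -
    have no_fix_g: "{v \<in> ?K. g v = v} = {}" using no_fix by auto
    have "signing g h f' e' ?K s" using s signing_commute by metis
    from total_sign_signing[OF g this K'(2) fin] show ?thesis unfolding no_fix_g by simp
  qed
  moreover have "total_sign f e ?K = total_sign f' e' ?K * e x"
  proof -
    let ?y = "min x (f x)"
    have "{v \<in> ?K. v < f v} = insert ?y {v \<in> ?K. v < f' v}"
      using fx fD(1) by (auto simp: f'_def min_def)
    moreover have "?y \<notin> {v \<in> ?K. v < f' v}" by (auto simp: f'_def min_def)
    moreover have "e ?y = e x" using fD(3) by (simp add: min_def)
    moreover have "prod e {v \<in> ?K. v < f' v} = prod e' {v \<in> ?K. v < f' v}"
      by (rule prod.cong) (auto simp: f'_def e'_def)
    ultimately show ?thesis using fin by (simp add: total_sign_def mult.commute)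
  qed
  moreover have "prod s ?K \<in> {1, -1}" using s1 by (rule prod_signs)
  \<comment> \<open>Equating the two evaluations of the product of \<open>s\<close> and cancelling
    the nonzero factor leaves \<open>s x * s (f x) = e x\<close>, the compatibility with the removed
    edge.\<close>
  ultimately have sx: "s (f x) = e x * s x"
    using total s1[of x] s1[OF fx(2)] fD(2)[of x] by auto
  have "s (f v) = e v * s v" if v: "v \<in> ?K" for v
  proof (cases "v \<in> {x, f x}")
    case True
    then show ?thesis using sx fD by auto
  next
    case False
    then show ?thesis using s v by (auto simp: signing_def f'_def e'_def)
  qed
  then show ?thesis using s by (auto simp: signing_def)
qed

section \<open>Planarity of a single diagram\<close>

abbreviation vertex :: "nat \<Rightarrow> complex" where
  "vertex v \<equiv> Complex (real v) 0"

text \<open>By Thales, the circle whose diameter joins \<open>i\<close> and \<open>j\<close> is the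
  zero set of this quadratic expression, the power of \<open>z\<close> with respect to the circle.
  It is negative inside and positive outside, so its sign tests nesting and separation.\<close>

lemma curve_Cup_iff:
  assumes "i < j"
  shows "z \<in> curve m (Cup i j) \<longleftrightarrow>
     Im z \<le> 0 \<and> (Re z - real i) * (Re z - real j) + (Im z)\<^sup>2 = 0"
proof -
  have "dist (Complex ((real i + real j) / 2) 0) z = (real j - real i) / 2 \<longleftrightarrow>
      (dist (Complex ((real i + real j) / 2) 0) z)\<^sup>2 = ((real j - real i) / 2)\<^sup>2"
    using assms by (subst power2_eq_iff_nonneg) auto
  also have "(dist (Complex ((real i + real j) / 2) 0) z)\<^sup>2
      = ((real i + real j) / 2 - Re z)\<^sup>2 + (Im z)\<^sup>2"
    by (simp add: dist_norm cmod_power2)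
  also have "\<dots> = ((real j - real i) / 2)\<^sup>2 \<longleftrightarrow>
      (Re z - real i) * (Re z - real j) + (Im z)\<^sup>2 = 0"
    by (auto simp: power2_eq_square field_simps)
  finally show ?thesis by (auto simp: dist_commute)
qed

lemma curve_Ray_iff: "z \<in> curve m (Ray i) \<longleftrightarrow> Re z = real i \<and> Im z \<le> 0 \<and> - real m \<le> Im z"
proof
  assume "z \<in> curve m (Ray i)"
  then obtain u where "0 \<le> u" "u \<le> 1"
    "z = (1 - u) *\<^sub>R Complex (real i) 0 + u *\<^sub>R Complex (real i) (- real m)"
    by (auto simp: in_segment)
  then show "Re z = real i \<and> Im z \<le> 0 \<and> - real m \<le> Im z"
    by (auto simp: mult_left_le_one_le left_diff_distrib)
next
  assume z: "Re z = real i \<and> Im z \<le> 0 \<and> - real m \<le> Im z"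
  then have "z = (1 - (- Im z / real m)) *\<^sub>R Complex (real i) 0
      + (- Im z / real m) *\<^sub>R Complex (real i) (- real m)"
    by (cases "m = 0") (auto simp: complex_eq_iff algebra_simps)
  moreover have "0 \<le> - Im z / real m" "- Im z / real m \<le> 1"
    using z by (cases "m = 0"; simp add: field_simps)+
  ultimately show "z \<in> curve m (Ray i)" unfolding curve.simps in_segment by blast
qed

text \<open>The expression is the power of \<open>z\<close> with respect to the outer circle. It
  drops strictly when an interval containing \<open>Re z\<close> is widened at both ends.\<close>

lemma ball_Cup_mono:
  assumes "i' < i" "i < j" "j < j'" "z \<in> curve m (Cup i j)"
  shows "(Re z - real i') * (Re z - real j') + (Im z)\<^sup>2 < 0"
proof -
  have z: "(Re z - i) * (Re z - j) + (Im z)\<^sup>2 = 0" using assms curve_Cup_iff by blast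
  have x: "real i \<le> Re z \<and> Re z \<le> real j"
  proof -
    have "(Re z - i) * (Re z - j) \<le> 0" using z by (smt (verit) zero_le_power2)
    then show ?thesis using assms(2) by (auto simp: mult_le_0_iff)
  qed
  have "(Re z - i') * (Re z - j') - (Re z - i) * (Re z - j)
     = (real i - i') * (Re z - j') + (Re z - i) * (real j - j')" by (simp add: algebra_simps)
  moreover have "(real i - i') * (Re z - j') < 0"
    using assms x by (intro mult_pos_neg) auto
  moreover have "(Re z - i) * (real j - j') \<le> 0"
    using assms x by (intro mult_nonneg_nonpos) auto
  ultimately show ?thesis using z by linarith
qed

lemma path_crosses_level:
  fixes \<phi> :: "complex \<Rightarrow> real"
  assumes "path g" "continuous_on UNIV \<phi>" "\<phi> (pathstart g) \<le> c" "c \<le> \<phi> (pathfinish g)"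
  obtains z where "z \<in> path_image g" "\<phi> z = c"
proof -
  have "connected (\<phi> ` path_image g)"
    using assms by (intro connected_continuous_image connected_path_image)
      (auto intro: continuous_on_subset)
  moreover have "\<phi> (pathstart g) \<in> \<phi> ` path_image g" "\<phi> (pathfinish g) \<in> \<phi> ` path_image g" by auto
  ultimately have "c \<in> \<phi> ` path_image g" using assms by (meson connected_contains_Icc atLeastAtMost_iff subsetD)
  then show ?thesis using that by auto
qed

text \<open>The inequality of arithmetic and geometric means bounds the depth of a semicircle, so
  that its crossing with a vertical line still lies on the ray of length \<open>m\<close>.\<close>

lemma sqrt_mult_le:
  assumes "(0::real) \<le> x" "0 \<le> y" "x + y \<le> c"
  shows "sqrt (x * y) \<le> c"
proof -
  have "sqrt (x * y) \<le> (x + y) / 2" by (rule arith_geo_mean_sqrt) (use assms in auto)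
  then show ?thesis using assms by simp
qed

text \<open>Numbers incident with no cup are fixed by default, including those outside
  \<open>{1..m}\<close>. For a cup diagram this is therefore an involution of all natural numbers,
  as \<open>sign_change\<close> demands.\<close>

definition mate :: "diagram \<Rightarrow> nat \<Rightarrow> nat" where
  "mate d v = (if \<exists>w. Cup v w \<in> strands d \<or> Cup w v \<in> strands d
               then SOME w. Cup v w \<in> strands d \<or> Cup w v \<in> strands d else v)"

section \<open>Order relations between strands forced by planarity and by dots\<close>

locale cup_diag =
  fixes m :: nat and d :: diagram
  assumes cup_diagram: "cup_diagram m d"
begin

lemma ends_subset: "s \<in> strands d \<Longrightarrow> ends s \<subseteq> {1..m}"
  and Cup_less: "Cup i j \<in> strands d \<Longrightarrow> i < j"
  and strand_exists: "v \<in> {1..m} \<Longrightarrow> \<exists>s\<in>strands d. v \<in> ends s"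
  and dotted_subset: "s \<in> dotted d \<Longrightarrow> s \<in> strands d"
  and dotted_accessible: "s \<in> dotted d \<Longrightarrow> accessible m (strands d) s"
  using cup_diagram unfolding cup_diagram_def by blast+

lemma strand_unique:
  assumes "s \<in> strands d" "t \<in> strands d" "v \<in> ends s" "v \<in> ends t"
  shows "s = t"
proof -
  have "\<exists>!s. s \<in> strands d \<and> v \<in> ends s"
    using cup_diagram ends_subset[OF assms(1)] assms(3) unfolding cup_diagram_def by blast
  then show ?thesis using assms by blast
qed

lemma curve_disjoint:
  assumes "s \<in> strands d" "t \<in> strands d" "z \<in> curve m s" "z \<in> curve m t"
  shows "s = t"
  using cup_diagram assms unfolding cup_diagram_def pairwise_def disjnt_iff by blast

lemma vertex_in_curve: "s \<in> strands d \<Longrightarrow> v \<in> ends s \<Longrightarrow> vertex v \<in> curve m s"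
proof (cases s)
  case (Cup i j)
  assume "s \<in> strands d" "v \<in> ends s"
  then show ?thesis using Cup curve_Cup_iff[OF Cup_less] by (auto simp del: curve.simps)
next
  case (Ray i)
  assume "s \<in> strands d" "v \<in> ends s"
  then show ?thesis using Ray by (auto simp: curve_Ray_iff simp del: curve.simps)
qed

lemma mate_Cup:
  assumes "Cup i j \<in> strands d"
  shows "mate d i = j" "mate d j = i"
proof -
  have *: "(Cup i w \<in> strands d \<or> Cup w i \<in> strands d) \<longleftrightarrow> w = j"
    "(Cup j w \<in> strands d \<or> Cup w j \<in> strands d) \<longleftrightarrow> w = i" for w
    using strand_unique[OF assms, of "Cup i w" i] strand_unique[OF assms, of "Cup w i" i]
      strand_unique[OF assms, of "Cup j w" j] strand_unique[OF assms, of "Cup w j" j]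
      Cup_less[OF assms] assms
    by auto
  show "mate d i = j" "mate d j = i" unfolding mate_def * by auto
qed

lemma mate_Ray:
  assumes "Ray i \<in> strands d"
  shows "mate d i = i"
proof -
  have "Cup i w \<notin> strands d" "Cup w i \<notin> strands d" for w
    using strand_unique[OF assms, of "Cup i w" i] strand_unique[OF assms, of "Cup w i" i] by auto
  then show ?thesis by (simp add: mate_def)
qed

lemma mate_cases:
  assumes "v \<in> {1..m}"
  obtains "Cup v (mate d v) \<in> strands d" "v < mate d v"
    | "Cup (mate d v) v \<in> strands d" "mate d v < v"
    | "Ray v \<in> strands d" "mate d v = v"
proof -
  obtain s where s: "s \<in> strands d" "v \<in> ends s" using strand_exists assms by blast
  show ?thesis
  proof (cases s)
    case (Cup i j)
    then have ij: "Cup i j \<in> strands d" and v: "v = i \<or> v = j" using s by auto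
    show ?thesis using that(1,2) mate_Cup[OF ij] Cup_less[OF ij] ij v by auto
  next
    case (Ray i)
    then show ?thesis using s that(3) mate_Ray by auto
  qed
qed

lemma mate_outside:
  assumes "v \<notin> {1..m}"
  shows "mate d v = v"
proof -
  have "Cup v w \<notin> strands d" "Cup w v \<notin> strands d" for w
    using assms ends_subset[of "Cup v w"] ends_subset[of "Cup w v"] by auto
  then show ?thesis by (simp add: mate_def)
qed

lemma mate_mate [simp]: "mate d (mate d v) = v"
proof (cases "v \<in> {1..m}")
  case True
  then show ?thesis
  proof (cases rule: mate_cases)
    case 1
    show ?thesis by (rule mate_Cup(2)[OF 1(1)])
  next
    case 2
    show ?thesis by (rule mate_Cup(1)[OF 2(1)])
  qed simp
next
  case False
  then show ?thesis using mate_outside by metis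
qed

lemma mate_in:
  assumes "v \<in> {1..m}"
  shows "mate d v \<in> {1..m}"
proof (rule ccontr)
  assume "mate d v \<notin> {1..m}"
  from mate_outside[OF this] have "mate d v = v" by (simp only: mate_mate)
  with assms \<open>mate d v \<notin> {1..m}\<close> show False by simp
qed

lemma Ray_iff: "Ray v \<in> strands d \<longleftrightarrow> v \<in> {1..m} \<and> mate d v = v"
proof
  assume "v \<in> {1..m} \<and> mate d v = v"
  then show "Ray v \<in> strands d" using mate_cases[of v] by (metis less_irrefl)
next
  assume "Ray v \<in> strands d"
  from mate_Ray[OF this] ends_subset[OF this] show "v \<in> {1..m} \<and> mate d v = v" by simp
qed

lemma not_crossing:
  assumes "Cup i j \<in> strands d" "Cup i' j' \<in> strands d" "i < i'" "i' < j"
  shows "j' < j"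
proof (rule ccontr)
  assume "\<not> j' < j"
  have ne: "Cup i j \<noteq> Cup i' j'" using assms by auto
  have "j \<noteq> j'"
  proof
    assume "j = j'"
    then have "Cup i j = Cup i' j'" by (intro strand_unique[OF assms(1,2), of j]) simp_all
    then show False using ne by blast
  qed
  then have jj: "j < j'" using \<open>\<not> j' < j\<close> by simp
  define D where "D = (real i' + real j') - (real i + real j)"
  have D: "D > 0" using jj assms by (simp add: D_def)
  \<comment> \<open>The radical axis: the power for \<open>i\<close>, \<open>j\<close> minus the
    power for \<open>i'\<close>, \<open>j'\<close> is linear in \<open>x\<close> with slope
    \<open>D\<close>, and this is its zero. The interlacing of the ends places it between
    \<open>i\<close> and \<open>j\<close>, where both semicircles pass through the same point below
    the axis.\<close>
  define x where "x = (real i' * j' - real i * j) / D"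
  have xD: "x * D = real i' * j' - real i * j" using D by (simp add: x_def)
  have "(x - i) * D = (real i' - i) * (real j' - i)" "(j - x) * D = (real j - i') * (real j' - j)"
    using xD unfolding left_diff_distrib by (simp_all add: D_def algebra_simps)
  moreover have "(real i' - i) * (real j' - i) \<ge> 0" "(real j - i') * (real j' - j) \<ge> 0"
    using assms jj by auto
  ultimately have x: "x - i \<ge> 0" "j - x \<ge> 0" using D by (metis mult_less_0_iff not_less)+
  define y where "y = - sqrt ((x - i) * (j - x))"
  have y: "y \<le> 0" "y\<^sup>2 = (x - i) * (j - x)" using x by (auto simp: y_def)
  have "Complex x y \<in> curve m (Cup i j)"
    using Cup_less[OF assms(1)] y by (simp add: curve_Cup_iff algebra_simps del: curve.simps)
  moreover have "(x - i') * (x - j') + y\<^sup>2 = 0"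
    using xD unfolding y(2) D_def by (simp add: algebra_simps)
  then have "Complex x y \<in> curve m (Cup i' j')"
    using Cup_less[OF assms(2)] y(1) by (simp add: curve_Cup_iff del: curve.simps)
  ultimately show False using curve_disjoint assms(1,2) ne by blast
qed

lemma not_Ray_under_Cup:
  assumes "Cup i j \<in> strands d" "Ray v \<in> strands d" "i < v"
  shows "j < v"
proof (rule ccontr)
  assume "\<not> j < v"
  then have vj: "v \<le> j" by simp
  \<comment> \<open>The point of the semicircle vertically below \<open>v\<close>; for
    \<open>v = j\<close> it is the shared vertex.\<close>
  define y where "y = - sqrt ((real v - i) * (real j - v))"
  have y: "y \<le> 0" "y\<^sup>2 = (real v - i) * (real j - v)" using vj assms by (auto simp: y_def)
  have "j \<le> m" using ends_subset[OF assms(1)] by auto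
  then have "- real m \<le> y" unfolding y_def neg_le_iff_le
    using vj assms by (intro sqrt_mult_le) auto
  then have "Complex (real v) y \<in> curve m (Ray v)" using y by (simp add: curve_Ray_iff del: curve.simps)
  moreover have "Complex (real v) y \<in> curve m (Cup i j)"
    using Cup_less[OF assms(1)] y by (simp add: curve_Cup_iff algebra_simps del: curve.simps)
  ultimately show False using curve_disjoint assms(1,2) by blast
qed

lemma Re_curve_le:
  assumes "s \<in> strands d" "z \<in> curve m s"
  shows "Re z \<le> Max (ends s)"
proof (cases s)
  case (Cup i j)
  then have ij: "i < j" using Cup_less assms by blast
  have "(Re z - i) * (Re z - j) + (Im z)\<^sup>2 = 0" using assms Cup curve_Cup_iff[OF ij] by blast
  then have "(Re z - i) * (Re z - j) \<le> 0" by (smt (verit) zero_le_power2)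
  then show ?thesis using ij Cup by (auto simp: mult_le_0_iff)
next
  case (Ray i)
  then show ?thesis using assms curve_Ray_iff by auto
qed

text \<open>Inside the rectangle a ray is the whole vertical line through its vertex. If no part of
  \<open>s\<close> lay to the right of it, a path from \<open>s\<close> to the right edge would have
  to meet it.\<close>

lemma Ray_left_of_dotted:
  assumes s: "s \<in> dotted d" and v: "Ray v \<in> strands d" "Ray v \<noteq> s"
  shows "v < Max (ends s)"
proof (rule ccontr)
  assume *: "\<not> v < Max (ends s)"
  obtain g where g: "path g" "path_image g \<subseteq> rectangle m" "pathstart g \<in> curve m s"
    "Re (pathfinish g) = real m + 1" "path_image g \<inter> (\<Union>t\<in>strands d - {s}. curve m t) = {}"
    using dotted_accessible[OF s] unfolding accessible_def by blast
  have "Re (pathstart g) \<le> real v"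
    using Re_curve_le[OF dotted_subset[OF s] g(3)] * by linarith
  moreover have "real v \<le> Re (pathfinish g)" using g(4) ends_subset[OF v(1)] by auto
  ultimately obtain z where z: "z \<in> path_image g" "Re z = real v"
    by (rule path_crosses_level[OF g(1) continuous_on_Re[OF continuous_on_id]])
  moreover have "z \<in> rectangle m" using g z by blast
  ultimately have "z \<in> curve m (Ray v)"
    by (auto simp: curve_Ray_iff rectangle_def in_cbox_complex_iff simp del: curve.simps)
  then show False using g(5) z v by blast
qed

text \<open>Otherwise \<open>not_crossing\<close> nests \<open>Cup i j\<close> under
  \<open>Cup i' j'\<close>, and the path to the right edge must leave the outer disc. It does so
  through the lower semicircle, since the rectangle contains no point above the axis.\<close>

lemma dotted_Cup_outermost:
  assumes s: "Cup i j \<in> dotted d" and t: "Cup i' j' \<in> strands d" "i' < i"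
  shows "j' < i"
proof (rule ccontr)
  assume "\<not> j' < i"
  have ij: "Cup i j \<in> strands d" using s dotted_subset by blast
  have "j' \<noteq> i" using strand_unique[OF ij t(1), of i] t Cup_less[OF ij] by auto
  then have "i < j'" using \<open>\<not> j' < i\<close> by simp
  then have jj: "j < j'" using not_crossing[OF t(1) ij t(2)] by simp
  define \<phi> where "\<phi> z = (Re z - real i') * (Re z - real j') + (Im z)\<^sup>2" for z
  obtain g where g: "path g" "path_image g \<subseteq> rectangle m" "pathstart g \<in> curve m (Cup i j)"
    "Re (pathfinish g) = real m + 1" "path_image g \<inter> (\<Union>t\<in>strands d - {Cup i j}. curve m t) = {}"
    using dotted_accessible[OF s] unfolding accessible_def by blast
  have "\<phi> (pathstart g) \<le> 0"
    using ball_Cup_mono[OF t(2) Cup_less[OF ij] jj g(3)] by (simp add: \<phi>_def)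
  moreover have "j' \<le> m" using ends_subset[OF t(1)] by auto
  then have "0 \<le> \<phi> (pathfinish g)"
    using Cup_less[OF t(1)] by (auto simp: \<phi>_def g(4) intro!: add_nonneg_nonneg mult_nonneg_nonneg)
  moreover have "continuous_on UNIV \<phi>" unfolding \<phi>_def by (intro continuous_intros)
  ultimately obtain z where z: "z \<in> path_image g" "\<phi> z = 0"
    using path_crosses_level[OF g(1)] by metis
  moreover have "z \<in> rectangle m" using g z by blast
  ultimately have "z \<in> curve m (Cup i' j')"
    using Cup_less[OF t(1)]
    by (auto simp: curve_Cup_iff \<phi>_def rectangle_def in_cbox_complex_iff simp del: curve.simps)
  then show False using g(5) z t by blast
qed

text \<open>This and the next two lemmas supply intervals stable under \<open>mate d\<close>, in
  which all vertices except fixed points are paired off. The later parity counts rest on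
  them.\<close>

lemma mate_between:
  assumes "Cup i j \<in> strands d" "i < v" "v < j"
  shows "mate d v \<noteq> v" "i < mate d v" "mate d v < j"
proof -
  have V: "v \<in> {1..m}" using ends_subset[OF assms(1)] assms by auto
  have ne: "mate d v \<noteq> i" "mate d v \<noteq> j"
    using assms(2,3) mate_Cup[OF assms(1)] mate_mate[of v] by (metis less_irrefl)+
  have "mate d v \<noteq> v \<and> i < mate d v \<and> mate d v < j"
    using V
  proof (cases rule: mate_cases)
    case 1
    then show ?thesis using not_crossing[OF assms(1) 1(1)] assms by simp
  next
    case 2
    then show ?thesis using not_crossing[OF 2(1) assms(1)] assms ne by linarith
  next
    case 3
    then show ?thesis using not_Ray_under_Cup[OF assms(1) 3(1)] assms by simp
  qed
  then show "mate d v \<noteq> v" "i < mate d v" "mate d v < j" by auto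
qed

lemma mate_left_of_Ray:
  assumes "Ray r \<in> strands d" "v < r"
  shows "mate d v < r"
proof (cases "v \<in> {1..m}")
  case True
  then show ?thesis
    using not_Ray_under_Cup[OF _ assms(1)] assms(2) by (cases rule: mate_cases) auto
qed (use assms mate_outside[of v] in simp)

lemma mate_left_of_dotted:
  assumes "Cup i j \<in> dotted d" "v < i"
  shows "mate d v < i"
proof (cases "v \<in> {1..m}")
  case True
  then show ?thesis
    using dotted_Cup_outermost[OF assms(1)] assms(2) by (cases rule: mate_cases) auto
qed (use assms mate_outside[of v] in simp)

lemma Ray_left_of_dotted_Cup:
  assumes "Cup i j \<in> dotted d" "Ray r \<in> strands d"
  shows "r < i"
proof -
  have ij: "Cup i j \<in> strands d" using assms dotted_subset by blast
  have "r < j" using Ray_left_of_dotted[OF assms] Cup_less[OF ij] by auto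
  moreover have "r \<noteq> i" using strand_unique[OF ij assms(2), of i] by auto
  ultimately show ?thesis using not_Ray_under_Cup[OF ij assms(2)] by linarith
qed

text \<open>Consequently q is prescribed at precisely the rays that are not rightmost, and p or -p
  at the rightmost one.\<close>

lemma dotted_Ray_rightmost: "Ray i \<in> dotted d \<Longrightarrow> rightmost_ray d i"
  using Ray_left_of_dotted[of "Ray i"] dotted_subset[of "Ray i"]
  unfolding rightmost_ray_def by fastforce

end

section \<open>Signs and curves\<close>

text \<open>Both orientations of the cup are tested, so that the value agrees at its two
  ends.\<close>

definition edge_sign :: "diagram \<Rightarrow> nat \<Rightarrow> real" where
  "edge_sign d v = (if mate d v = v \<or> Cup v (mate d v) \<in> dotted d \<or> Cup (mate d v) v \<in> dotted d
                    then 1 else - 1)"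

definition ray_value :: "diagram \<Rightarrow> nat \<Rightarrow> real ^ 3" where
  "ray_value d v = (if Ray v \<in> dotted d then pole_p
                    else if rightmost_ray d v then - pole_p else point_q)"

definition dots :: "diagram \<Rightarrow> nat set \<Rightarrow> nat" where
  "dots d K = card {s \<in> dotted d. ends s \<subseteq> K}"

definition dotted_cups :: "diagram \<Rightarrow> nat set \<Rightarrow> nat set" where
  "dotted_cups d K = {v \<in> K. v < mate d v \<and> Cup v (mate d v) \<in> dotted d}"

context cup_diag
begin

lemma sign_change_mate: "sign_change (mate d) (edge_sign d)"
proof -
  have "edge_sign d (mate d v) = edge_sign d v" for v
    by (cases "mate d v = v") (auto simp: edge_sign_def)
  moreover have "edge_sign d v \<in> {1, - 1}" "mate d v = v \<Longrightarrow> edge_sign d v = 1" for v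
    by (simp_all add: edge_sign_def)
  ultimately show ?thesis unfolding sign_change_def by (metis mate_mate)
qed

lemma edge_sign_Cup:
  assumes "Cup i j \<in> strands d"
  shows "edge_sign d i = (if Cup i j \<in> dotted d then 1 else - 1)"
    "edge_sign d j = (if Cup i j \<in> dotted d then 1 else - 1)"
proof -
  have "Cup j i \<notin> dotted d" "i \<noteq> j"
    using Cup_less[OF assms] Cup_less[of j i] dotted_subset[of "Cup j i"] by auto
  then show "edge_sign d i = (if Cup i j \<in> dotted d then 1 else - 1)"
    "edge_sign d j = (if Cup i j \<in> dotted d then 1 else - 1)"
    unfolding edge_sign_def mate_Cup[OF assms] by simp_all
qed

lemma S_space_iff:
  "x \<in> S_space m d \<longleftrightarrow> x \<in> topspace (sphere_power {1..m}) \<and>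
     (\<forall>v\<in>{1..m}. x (mate d v) = edge_sign d v *\<^sub>R x v) \<and>
     (\<forall>v. Ray v \<in> strands d \<longrightarrow> x v = ray_value d v)"
proof -
  have "(\<forall>v\<in>{1..m}. x (mate d v) = edge_sign d v *\<^sub>R x v) \<longleftrightarrow>
     (\<forall>i j. Cup i j \<in> strands d \<and> Cup i j \<notin> dotted d \<longrightarrow> x i = - x j) \<and>
     (\<forall>i j. Cup i j \<in> strands d \<and> Cup i j \<in> dotted d \<longrightarrow> x i = x j)" (is "?L \<longleftrightarrow> ?R")
  proof
    assume L: ?L
    have *: "x j = (if Cup i j \<in> dotted d then 1 else - 1) *\<^sub>R x i" if ij: "Cup i j \<in> strands d" for i j
    proof -
      have "i \<in> {1..m}" using ends_subset[OF ij] by simp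
      then show ?thesis using L mate_Cup[OF ij] edge_sign_Cup[OF ij] by metis
    qed
    have "x i = - x j" if "Cup i j \<in> strands d" "Cup i j \<notin> dotted d" for i j
      using *[OF that(1)] that(2) by simp
    moreover have "x i = x j" if "Cup i j \<in> strands d" "Cup i j \<in> dotted d" for i j
      using *[OF that(1)] that(2) by simp
    ultimately show ?R by blast
  next
    assume R: ?R
    show ?L
    proof
      fix v assume "v \<in> {1..m}"
      then show "x (mate d v) = edge_sign d v *\<^sub>R x v"
      proof (cases rule: mate_cases)
        case 1
        then show ?thesis
          using R edge_sign_Cup(1)[OF 1(1)] by (cases "Cup v (mate d v) \<in> dotted d") simp_all
      next
        case 2
        then show ?thesis
          using R edge_sign_Cup(2)[OF 2(1)] by (cases "Cup (mate d v) v \<in> dotted d") simp_all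
      qed (simp add: edge_sign_def)
    qed
  qed
  moreover have "(\<forall>v. Ray v \<in> strands d \<longrightarrow> x v = ray_value d v) \<longleftrightarrow>
     (\<forall>i. Ray i \<in> strands d \<and> Ray i \<in> dotted d \<longrightarrow> x i = pole_p) \<and>
     (\<forall>i. Ray i \<in> strands d \<and> Ray i \<notin> dotted d \<and> rightmost_ray d i \<longrightarrow> x i = - pole_p) \<and>
     (\<forall>i. Ray i \<in> strands d \<and> Ray i \<notin> dotted d \<and> \<not> rightmost_ray d i \<longrightarrow> x i = point_q)"
    unfolding ray_value_def by auto
  ultimately show ?thesis unfolding S_space_def by blast
qed

text \<open>Every cup contributes -1, and a dot cancels this by a second factor -1, so the two
  counts add in the exponent.\<close>

lemma total_sign_mate:
  assumes "finite K"
  shows "total_sign (mate d) (edge_sign d) K =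
    (- 1) ^ (card {v \<in> K. v < mate d v} + card (dotted_cups d K))"
proof -
  let ?A = "{v \<in> K. v < mate d v}"
  have "edge_sign d v = (- 1) * (if v \<in> dotted_cups d K then - 1 else 1)" if v: "v \<in> ?A" for v
  proof -
    have "Cup (mate d v) v \<notin> dotted d" using v Cup_less[of "mate d v" v] dotted_subset by fastforce
    then show ?thesis using v by (auto simp: edge_sign_def dotted_cups_def)
  qed
  then have "total_sign (mate d) (edge_sign d) K
      = (\<Prod>v\<in>?A. (- 1) * (if v \<in> dotted_cups d K then - 1 else 1))"
    unfolding total_sign_def by (rule prod.cong[OF refl])
  also have "\<dots> = (- 1) ^ card ?A * (\<Prod>v\<in>?A. if v \<in> dotted_cups d K then - 1 else 1)"
    by (simp only: prod.distrib prod_constant)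
  also have "(\<Prod>v\<in>?A. if v \<in> dotted_cups d K then - 1 else 1 :: real) = (- 1) ^ card (dotted_cups d K)"
  proof -
    have "?A \<inter> dotted_cups d K = dotted_cups d K" by (auto simp: dotted_cups_def)
    then show ?thesis using assms by (simp add: prod.If_cases)
  qed
  finally show ?thesis by (simp add: power_add)
qed

lemma dots_eq:
  assumes "K \<subseteq> {1..m}" "mate d ` K \<subseteq> K"
  shows "dots d K = card (dotted_cups d K) + card {v \<in> K. Ray v \<in> dotted d}"
proof -
  have "{s \<in> dotted d. ends s \<subseteq> K} =
    (\<lambda>v. Cup v (mate d v)) ` dotted_cups d K \<union> Ray ` {v \<in> K. Ray v \<in> dotted d}" (is "?L = ?A \<union> ?B")
  proof
    show "?L \<subseteq> ?A \<union> ?B"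
    proof
      fix s assume s: "s \<in> ?L"
      then have sd: "s \<in> strands d" using dotted_subset by simp
      show "s \<in> ?A \<union> ?B"
      proof (cases s)
        case (Cup i j)
        then show ?thesis
          using s mate_Cup[of i j] Cup_less[of i j] sd by (auto simp: dotted_cups_def)
      next
        case (Ray i)
        then show ?thesis using s by auto
      qed
    qed
    show "?A \<union> ?B \<subseteq> ?L" using assms by (auto simp: dotted_cups_def)
  qed
  moreover have "finite K" using assms finite_subset by blast
  then have "card (?A \<union> ?B) = card ?A + card ?B"
    by (intro card_Un_disjoint) (auto simp: dotted_cups_def)
  moreover have "card ?A = card (dotted_cups d K)" by (intro card_image) (auto simp: inj_on_def)
  moreover have "card ?B = card {v \<in> K. Ray v \<in> dotted d}" by (intro card_image) (auto simp: inj_on_def)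
  ultimately show ?thesis by (simp add: dots_def)
qed

section \<open>Point-set properties of the strands\<close>

lemma finite_strands: "finite (strands d)"
proof (rule finite_subset)
  show "strands d \<subseteq> (\<lambda>(i, j). Cup i j) ` ({1..m} \<times> {1..m}) \<union> Ray ` {1..m}"
  proof
    fix s assume "s \<in> strands d"
    then show "s \<in> (\<lambda>(i, j). Cup i j) ` ({1..m} \<times> {1..m}) \<union> Ray ` {1..m}"
      using ends_subset[of s] by (cases s) auto
  qed
qed simp

lemma ends_subset_iff:
  assumes "mate d ` K \<subseteq> K" "s \<in> strands d" "v \<in> ends s"
  shows "ends s \<subseteq> K \<longleftrightarrow> v \<in> K"
proof (cases s)
  case (Cup i j)
  then have ij: "Cup i j \<in> strands d" using assms by simp
  show ?thesis using assms(1,3) mate_Cup[OF ij] Cup by (auto simp: image_subset_iff)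
next
  case (Ray i)
  then show ?thesis using assms(3) by simp
qed

lemma curve_real_point:
  assumes "s \<in> strands d" "z \<in> curve m s" "Im z = 0"
  shows "\<exists>v\<in>ends s. z = vertex v"
proof (cases s)
  case (Cup i j)
  then have "(Re z - i) * (Re z - j) = 0"
    using assms curve_Cup_iff[OF Cup_less, of i j z m] by simp
  then show ?thesis using Cup assms(3) by (auto simp: complex_eq_iff)
next
  case (Ray i)
  then show ?thesis using assms by (auto simp: complex_eq_iff curve_Ray_iff simp del: curve.simps)
qed

lemma Im_curve:
  assumes "s \<in> strands d" "z \<in> curve m s"
  shows "Im z \<le> 0"
proof (cases s)
  case (Cup i j)
  then show ?thesis using assms curve_Cup_iff[OF Cup_less, of i j] by blast
next
  case (Ray i)
  then show ?thesis using assms by (simp add: curve_Ray_iff del: curve.simps)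
qed

lemma Im_Cup_bound:
  assumes "Cup i j \<in> strands d" "z \<in> curve m (Cup i j)"
  shows "- real m < Im z"
proof (rule ccontr)
  assume "\<not> - real m < Im z"
  then have "real m * real m \<le> (- Im z) * (- Im z)" by (intro mult_mono) auto
  then have "real m * real m \<le> Im z * Im z" by simp
  moreover have ij: "1 \<le> i" "i < j" "j \<le> m" using ends_subset[OF assms(1)] Cup_less[OF assms(1)] by auto
  moreover have "(Re z - i) * (Re z - j) + (Im z)\<^sup>2 = 0" using assms curve_Cup_iff ij by blast
  \<comment> \<open>The minimum is minus a quarter of the squared width; the cruder bound suffices
    because \<open>j - i\<close> is smaller than \<open>m\<close>.\<close>
  moreover have "(Re z - i) * (Re z - j) \<ge> - ((real j - i) * (real j - i))"
  proof -
    have "(Re z - i) * (Re z - j) + (real j - i) * (real j - i)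
        = (Re z - (real i + j) / 2)\<^sup>2 + 3 / 4 * (real j - i)\<^sup>2"
      by (simp add: power2_eq_square field_simps)
    moreover have "\<dots> \<ge> 0" by simp
    ultimately show ?thesis by linarith
  qed
  moreover have "(real j - i) * (real j - i) < real m * real m"
    using ij by (intro mult_strict_mono) auto
  ultimately show False by (simp add: power2_eq_square)
qed

lemma compact_curve: "compact (curve m s)"
proof (cases s)
  case (Cup i j)
  have "closed {z. Im z \<le> 0}" by (simp add: closed_halfspace_Im_le)
  then have "compact (sphere (Complex ((real i + real j) / 2) 0) ((real j - real i) / 2) \<inter> {z. Im z \<le> 0})"
    by (intro compact_Int_closed) auto
  moreover have "curve m (Cup i j) = sphere (Complex ((real i + real j) / 2) 0) ((real j - real i) / 2) \<inter> {z. Im z \<le> 0}"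
    by auto
  ultimately show ?thesis by (simp only: Cup)
qed auto

text \<open>The semicircle is the graph of a continuous function on an interval.\<close>

lemma connected_Cup:
  assumes "i < j"
  shows "connected (curve m (Cup i j))"
proof -
  let ?h = "\<lambda>x. Complex x (- sqrt ((x - i) * (real j - x)))"
  have "curve m (Cup i j) = ?h ` {real i..real j}"
  proof
    show "?h ` {real i..real j} \<subseteq> curve m (Cup i j)"
    proof
      fix z assume "z \<in> ?h ` {real i..real j}"
      then obtain x where x: "real i \<le> x" "x \<le> real j" "z = ?h x" by auto
      then have "(x - real i) * (real j - x) \<ge> 0" by simp
      then have "(x - real i) * (x - real j) + (- sqrt ((x - real i) * (real j - x)))\<^sup>2 = 0"
        by (simp add: algebra_simps)
      then show "z \<in> curve m (Cup i j)"
        using \<open>(x - real i) * (real j - x) \<ge> 0\<close> x(3)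
        unfolding curve_Cup_iff[OF assms] by simp
    qed
    show "curve m (Cup i j) \<subseteq> ?h ` {real i..real j}"
    proof
      fix z assume "z \<in> curve m (Cup i j)"
      then have z: "Im z \<le> 0" "(Re z - i) * (Re z - j) + (Im z)\<^sup>2 = 0"
        using assms curve_Cup_iff by blast+
      then have "(Re z - i) * (Re z - j) \<le> 0" by (smt (verit) zero_le_power2)
      then have "Re z \<in> {real i..real j}" using assms by (auto simp: mult_le_0_iff)
      moreover have "(Im z)\<^sup>2 = (Re z - i) * (real j - Re z)" using z(2) by (simp add: algebra_simps)
      then have "sqrt ((Re z - i) * (real j - Re z)) = - Im z"
        using z(1) by (metis abs_of_nonpos real_sqrt_abs)
      ultimately show "z \<in> ?h ` {real i..real j}" by (intro image_eqI[of _ _ "Re z"]) (auto simp: complex_eq_iff)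
    qed
  qed
  moreover have "continuous_on {real i..real j} ?h"
    unfolding Complex_eq by (intro continuous_intros)
  ultimately show ?thesis using connected_continuous_image by (metis connected_Icc)
qed

lemma connected_curve:
  assumes "s \<in> strands d"
  shows "connected (curve m s)"
proof (cases s)
  case (Cup i j)
  then show ?thesis using assms connected_Cup[OF Cup_less] by blast
qed auto

end

lemma connected_component_set_eq_clopen:
  fixes X :: "'a :: topological_space set"
  assumes "A \<subseteq> connected_component_set X x" "x \<in> A" "closed A" "closed B" "X \<subseteq> A \<union> B" "A \<inter> B \<inter> X = {}"
  shows "connected_component_set X x = A"
proof
  let ?C = "connected_component_set X x"
  have C: "connected ?C" "?C \<subseteq> X" by (auto simp: connected_component_subset)
  show "?C \<subseteq> A"
  proof (rule ccontr)
    assume "\<not> ?C \<subseteq> A"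
    then have "B \<inter> ?C \<noteq> {}" "A \<inter> ?C \<noteq> {}" using C(2) assms by blast+
    moreover have "?C \<subseteq> A \<union> B" "A \<inter> B \<inter> ?C = {}" using C(2) assms by blast+
    ultimately show False
      using C(1) assms(3,4) unfolding connected_closed by blast
  qed
qed (rule assms(1))

section \<open>Connected components of the circle diagram\<close>

declare curve.simps [simp del]

locale circle_pair = a: cup_diag m a + b: cup_diag m b for m a b
begin

abbreviation orb :: "nat \<Rightarrow> nat set" where
  "orb v \<equiv> orbit2 (mate a) (mate b) v"

definition invariant :: "nat set \<Rightarrow> bool" where
  "invariant K \<longleftrightarrow> K \<subseteq> {1..m} \<and> mate a ` K \<subseteq> K \<and> mate b ` K \<subseteq> K"

text \<open>Strands are selected by all their ends. When \<open>K\<close> is invariant, no strand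
  has ends both inside and outside \<open>K\<close>, so the curves over \<open>K\<close> and over
  its complement make up the whole diagram.\<close>

definition subpicture :: "nat set \<Rightarrow> complex set" where
  "subpicture K = (\<Union>s\<in>{s \<in> strands a. ends s \<subseteq> K}. cnj ` curve m s) \<union>
             (\<Union>s\<in>{s \<in> strands b. ends s \<subseteq> K}. curve m s)"

lemma invariant_orb:
  assumes "v \<in> {1..m}"
  shows "invariant (orb v)"
  unfolding invariant_def
proof (intro conjI)
  show "orb v \<subseteq> {1..m}"
  proof (rule orbit2_least)
    show "mate a ` {1..m} \<subseteq> {1..m}" "mate b ` {1..m} \<subseteq> {1..m}"
      using a.mate_in b.mate_in by blast+
  qed (rule assms)
qed auto

lemma invariant_Diff:
  assumes "invariant K"
  shows "invariant ({1..m} - K)"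
  unfolding invariant_def
proof (intro conjI image_subsetI)
  fix v assume v: "v \<in> {1..m} - K"
  have "mate a v \<notin> K"
  proof
    assume "mate a v \<in> K"
    then have "mate a (mate a v) \<in> K" using assms unfolding invariant_def by blast
    then show False using v by simp
  qed
  then show "mate a v \<in> {1..m} - K" using v a.mate_in by blast
  have "mate b v \<notin> K"
  proof
    assume "mate b v \<in> K"
    then have "mate b (mate b v) \<in> K" using assms unfolding invariant_def by blast
    then show False using v by simp
  qed
  then show "mate b v \<in> {1..m} - K" using v b.mate_in by blast
qed auto

lemma finite_invariant: "invariant K \<Longrightarrow> finite K"
  unfolding invariant_def by (meson finite_atLeastAtMost finite_subset)

lemma subpicture_real_point:
  assumes "z \<in> subpicture K" "Im z = 0"
  shows "\<exists>v\<in>K. z = vertex v"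
  using assms(1) unfolding subpicture_def
proof
  assume "z \<in> (\<Union>s\<in>{s \<in> strands a. ends s \<subseteq> K}. cnj ` curve m s)"
  then obtain s w where s: "s \<in> strands a" "ends s \<subseteq> K" "w \<in> curve m s" "z = cnj w" by blast
  then have "Im w = 0" using assms(2) by simp
  then obtain v where "v \<in> ends s" "w = vertex v" using a.curve_real_point s by blast
  then show ?thesis using s by (auto simp: complex_eq_iff)
next
  assume "z \<in> (\<Union>s\<in>{s \<in> strands b. ends s \<subseteq> K}. curve m s)"
  then show ?thesis using b.curve_real_point assms(2) by blast
qed

text \<open>The picture determines \<open>K\<close>; hence distinct orbits have distinct components,
  as needed for counting circles.\<close>

lemma vertex_in_subpicture:
  assumes "invariant K"
  shows "vertex v \<in> subpicture K \<longleftrightarrow> v \<in> K"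
proof
  assume "vertex v \<in> subpicture K"
  then show "v \<in> K" using subpicture_real_point by fastforce
next
  assume v: "v \<in> K"
  have "v \<in> {1..m}" using assms v unfolding invariant_def by (meson subsetD)
  then obtain s where s: "s \<in> strands b" "v \<in> ends s" using b.strand_exists by (meson bexE)
  have "mate b ` K \<subseteq> K" using assms by (simp add: invariant_def)
  then have "ends s \<subseteq> K" using b.ends_subset_iff[OF _ s] v by simp
  then show "vertex v \<in> subpicture K" using s(1) b.vertex_in_curve[OF s] unfolding subpicture_def by blast
qed

lemma curve_subset_subpicture_a:
  assumes "invariant K" "s \<in> strands a"
  shows "cnj ` curve m s \<subseteq> subpicture K \<longleftrightarrow> ends s \<subseteq> K"
proof
  assume "cnj ` curve m s \<subseteq> subpicture K"
  moreover have "vertex v \<in> cnj ` curve m s" if "v \<in> ends s" for v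
    using a.vertex_in_curve[OF assms(2) that]
    by (intro image_eqI[of _ _ "vertex v"]) (auto simp: complex_eq_iff)
  ultimately show "ends s \<subseteq> K" using vertex_in_subpicture[OF assms(1)] by blast
next
  assume "ends s \<subseteq> K"
  with assms(2) show "cnj ` curve m s \<subseteq> subpicture K" unfolding subpicture_def by blast
qed

lemma curve_subset_subpicture_b:
  assumes "invariant K" "s \<in> strands b"
  shows "curve m s \<subseteq> subpicture K \<longleftrightarrow> ends s \<subseteq> K"
proof
  assume "curve m s \<subseteq> subpicture K"
  then show "ends s \<subseteq> K" using vertex_in_subpicture[OF assms(1)] b.vertex_in_curve[OF assms(2)] by blast
next
  assume "ends s \<subseteq> K"
  with assms(2) show "curve m s \<subseteq> subpicture K" unfolding subpicture_def by blast
qed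

text \<open>Strictly above the axis only strands of \<open>a\<close> occur, strictly below only
  strands of \<open>b\<close>, and on the axis only vertices. A common point thus yields a common
  strand, by disjointness within one diagram, or a common vertex.\<close>

lemma subpicture_disjoint:
  assumes "invariant K" "invariant L" "K \<inter> L = {}"
  shows "subpicture K \<inter> subpicture L = {}"
proof (rule ccontr)
  assume "subpicture K \<inter> subpicture L \<noteq> {}"
  then obtain z where z: "z \<in> subpicture K" "z \<in> subpicture L" by blast
  consider "Im z > 0" | "Im z < 0" | "Im z = 0" by linarith
  then show False
  proof cases
    case 1
    have *: "\<exists>s\<in>strands a. ends s \<subseteq> M \<and> cnj z \<in> curve m s" if "z \<in> subpicture M" for M
    proof -
      have "z \<notin> curve m s" if "s \<in> strands b" for s using b.Im_curve[OF that] 1 by fastforce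
      then show ?thesis using that by (auto simp: subpicture_def)
    qed
    obtain s t where "s \<in> strands a" "ends s \<subseteq> K" "t \<in> strands a" "ends t \<subseteq> L"
      "cnj z \<in> curve m s" "cnj z \<in> curve m t"
      using *[OF z(1)] *[OF z(2)] by blast
    moreover then have "s = t" using a.curve_disjoint by blast
    moreover have "ends s \<noteq> {}" by (cases s) auto
    ultimately show False using assms(3) by blast
  next
    case 2
    have *: "\<exists>s\<in>strands b. ends s \<subseteq> M \<and> z \<in> curve m s" if "z \<in> subpicture M" for M
    proof -
      have "z \<notin> cnj ` curve m s" if "s \<in> strands a" for s using a.Im_curve[OF that] 2 by fastforce
      then show ?thesis using that by (auto simp: subpicture_def)
    qed
    obtain s t where "s \<in> strands b" "ends s \<subseteq> K" "t \<in> strands b" "ends t \<subseteq> L"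
      "z \<in> curve m s" "z \<in> curve m t"
      using *[OF z(1)] *[OF z(2)] by blast
    moreover then have "s = t" using b.curve_disjoint by blast
    moreover have "ends s \<noteq> {}" by (cases s) auto
    ultimately show False using assms(3) by blast
  next
    case 3
    then show False using subpicture_real_point[OF z(1)] subpicture_real_point[OF z(2)] assms(3)
      by (auto simp: complex_eq_iff)
  qed
qed

lemma closed_subpicture: "closed (subpicture K)"
  unfolding subpicture_def
proof (intro closed_Un closed_UN ballI)
  show "closed (cnj ` curve m s)" for s
    using a.compact_curve by (intro compact_imp_closed compact_continuous_image continuous_intros)
  show "closed (curve m s)" for s using a.compact_curve compact_imp_closed by blast
qed (use a.finite_strands b.finite_strands in auto)

lemma circle_diagram_eq: "circle_diagram m a b = subpicture {1..m}"
proof -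
  have "{s \<in> strands a. ends s \<subseteq> {1..m}} = strands a" "{s \<in> strands b. ends s \<subseteq> {1..m}} = strands b"
    using a.ends_subset b.ends_subset by auto
  then show ?thesis unfolding circle_diagram_def picture_def subpicture_def by auto
qed

lemma subpicture_Un_Diff:
  assumes "invariant K"
  shows "subpicture {1..m} = subpicture K \<union> subpicture ({1..m} - K)"
proof -
  have K: "K \<subseteq> {1..m}" using assms by (simp add: invariant_def)
  have "ends s \<subseteq> K \<or> ends s \<subseteq> {1..m} - K" if s: "s \<in> strands a" for s
  proof -
    obtain v where v: "v \<in> ends s" by (cases s) auto
    then have "v \<in> {1..m}" using a.ends_subset[OF s] by blast
    then show ?thesis
      using a.ends_subset_iff[OF _ s v] assms invariant_Diff[OF assms] unfolding invariant_def
      by (metis DiffI)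
  qed
  moreover have "ends s \<subseteq> K \<or> ends s \<subseteq> {1..m} - K" if s: "s \<in> strands b" for s
  proof -
    obtain v where v: "v \<in> ends s" by (cases s) auto
    then have "v \<in> {1..m}" using b.ends_subset[OF s] by blast
    then show ?thesis
      using b.ends_subset_iff[OF _ s v] assms invariant_Diff[OF assms] unfolding invariant_def
      by (metis DiffI)
  qed
  ultimately have "{s \<in> strands d. ends s \<subseteq> {1..m}} = {s \<in> strands d. ends s \<subseteq> K} \<union> {s \<in> strands d. ends s \<subseteq> {1..m} - K}"
    if "d = a \<or> d = b" for d
    using that K by blast
  from this[of a] this[of b] show ?thesis unfolding subpicture_def by (simp add: UN_Un Un_ac)
qed

text \<open>Each move of an involution inside the orbit is realised by running along one connected
  strand.\<close>

lemma connected_component_vertices: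
  assumes "v \<in> {1..m}" "w \<in> orb v"
  shows "connected_component (subpicture {1..m}) (vertex v) (vertex w)"
  using assms(2)
proof induction
  case base
  have "invariant {1..m}" using invariant_Diff[of "{}"] by (simp add: invariant_def)
  then show ?case using vertex_in_subpicture assms(1) by simp
next
  case (left w)
  have w: "w \<in> {1..m}" using left.hyps invariant_orb[OF assms(1)] by (auto simp: invariant_def)
  then obtain s where s: "s \<in> strands a" "w \<in> ends s" "mate a w \<in> ends s"
  proof (cases rule: a.mate_cases)
    case 1 then show ?thesis using that by force
  next
    case 2 then show ?thesis using that by force
  next
    case 3 then show ?thesis using that by force
  qed
  have "connected (cnj ` curve m s)"
    by (intro connected_continuous_image a.connected_curve s continuous_intros)
  moreover have "cnj ` curve m s \<subseteq> subpicture {1..m}" using s a.ends_subset by (auto simp: subpicture_def)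
  moreover have "vertex u \<in> cnj ` curve m s" if "u \<in> ends s" for u
    using a.vertex_in_curve[OF s(1) that]
    by (intro image_eqI[of _ _ "vertex u"]) (auto simp: complex_eq_iff)
  ultimately have "connected_component (subpicture {1..m}) (vertex w) (vertex (mate a w))"
    using s unfolding connected_component_def by blast
  then show ?case using left.IH connected_component_trans by blast
next
  case (right w)
  have w: "w \<in> {1..m}" using right.hyps invariant_orb[OF assms(1)] by (auto simp: invariant_def)
  then obtain s where s: "s \<in> strands b" "w \<in> ends s" "mate b w \<in> ends s"
  proof (cases rule: b.mate_cases)
    case 1 then show ?thesis using that by force
  next
    case 2 then show ?thesis using that by force
  next
    case 3 then show ?thesis using that by force
  qed
  have "connected (curve m s)" by (rule b.connected_curve[OF s(1)])
  moreover have "curve m s \<subseteq> subpicture {1..m}" using s b.ends_subset by (auto simp: subpicture_def)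
  ultimately have "connected_component (subpicture {1..m}) (vertex w) (vertex (mate b w))"
    using s b.vertex_in_curve unfolding connected_component_def by blast
  then show ?case using right.IH connected_component_trans by blast
qed

lemma subpicture_subset_component:
  assumes "v \<in> {1..m}"
  shows "subpicture (orb v) \<subseteq> connected_component_set (subpicture {1..m}) (vertex v)"
proof
  fix z assume "z \<in> subpicture (orb v)"
  then obtain C u where C: "connected C" "C \<subseteq> subpicture {1..m}" "z \<in> C" "vertex u \<in> C" "u \<in> orb v"
    unfolding subpicture_def
  proof
    assume "z \<in> (\<Union>s\<in>{s \<in> strands a. ends s \<subseteq> orb v}. cnj ` curve m s)"
    then obtain s where s: "s \<in> strands a" "ends s \<subseteq> orb v" "z \<in> cnj ` curve m s" by blast
    obtain u where u: "u \<in> ends s" by (cases s) auto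
    have "connected (cnj ` curve m s)"
      by (intro connected_continuous_image a.connected_curve s continuous_intros)
    moreover have "cnj ` curve m s \<subseteq> subpicture {1..m}" using s a.ends_subset by (auto simp: subpicture_def)
    moreover have "vertex u \<in> cnj ` curve m s"
      using a.vertex_in_curve[OF s(1) u]
      by (intro image_eqI[of _ _ "vertex u"]) (auto simp: complex_eq_iff)
    ultimately show ?thesis using that s u by blast
  next
    assume "z \<in> (\<Union>s\<in>{s \<in> strands b. ends s \<subseteq> orb v}. curve m s)"
    then obtain s where s: "s \<in> strands b" "ends s \<subseteq> orb v" "z \<in> curve m s" by blast
    obtain u where u: "u \<in> ends s" by (cases s) auto
    have "curve m s \<subseteq> subpicture {1..m}" using s b.ends_subset by (auto simp: subpicture_def)
    moreover have "vertex u \<in> curve m s" by (rule b.vertex_in_curve[OF s(1) u])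
    ultimately show ?thesis using that[OF b.connected_curve[OF s(1)]] s u by blast
  qed
  have "connected_component (subpicture {1..m}) (vertex u) z"
    unfolding connected_component_def by (intro exI[of _ C] conjI C(1-4))
  then show "z \<in> connected_component_set (subpicture {1..m}) (vertex v)"
    using connected_component_vertices[OF assms C(5)] connected_component_trans by blast
qed

lemma components_eq: "components (circle_diagram m a b) = (\<lambda>v. subpicture (orb v)) ` {1..m}"
proof -
  \<comment> \<open>The picture of the orbit is closed and lies in the component of
    \<open>vertex v\<close>; the rest of the diagram is the picture of the complementary vertices,
    which is closed as well.\<close>
  have comp: "connected_component_set (subpicture {1..m}) (vertex v) = subpicture (orb v)" if v: "v \<in> {1..m}" for v
  proof (rule connected_component_set_eq_clopen[OF subpicture_subset_component[OF v]])
    note inv = invariant_orb[OF v]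
    show "vertex v \<in> subpicture (orb v)" using vertex_in_subpicture[OF inv] by simp
    show "subpicture {1..m} \<subseteq> subpicture (orb v) \<union> subpicture ({1..m} - orb v)"
      using subpicture_Un_Diff[OF inv] by simp
    show "subpicture (orb v) \<inter> subpicture ({1..m} - orb v) \<inter> subpicture {1..m} = {}"
      using subpicture_disjoint[OF inv invariant_Diff[OF inv]] by auto
  qed (rule closed_subpicture)+
  show ?thesis
  proof
    show "components (circle_diagram m a b) \<subseteq> (\<lambda>v. subpicture (orb v)) ` {1..m}"
    proof
      fix C assume "C \<in> components (circle_diagram m a b)"
      then obtain z where z: "z \<in> subpicture {1..m}" "C = connected_component_set (subpicture {1..m}) z"
        unfolding circle_diagram_eq components_def by auto
      have "\<exists>v\<in>{1..m}. z \<in> subpicture (orb v)"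
      proof -
        have *: "\<exists>v\<in>{1..m}. ends s \<subseteq> orb v" if s: "s \<in> strands a \<or> s \<in> strands b" for s
        proof -
          obtain v where v: "v \<in> ends s" by (cases s) auto
          then have vm: "v \<in> {1..m}" using s a.ends_subset b.ends_subset by blast
          show ?thesis
            using invariant_orb[OF vm] s vm a.ends_subset_iff[OF _ _ v] b.ends_subset_iff[OF _ _ v]
              orbit2.base[of v] unfolding invariant_def by metis
        qed
        from z(1) show ?thesis unfolding subpicture_def[of "{1..m}"]
        proof
          assume "z \<in> (\<Union>s\<in>{s \<in> strands a. ends s \<subseteq> {1..m}}. cnj ` curve m s)"
          then obtain s where s: "s \<in> strands a" "z \<in> cnj ` curve m s" by blast
          with * obtain v where "v \<in> {1..m}" "ends s \<subseteq> orb v" by metis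
          with s show ?thesis unfolding subpicture_def by blast
        next
          assume "z \<in> (\<Union>s\<in>{s \<in> strands b. ends s \<subseteq> {1..m}}. curve m s)"
          then obtain s where s: "s \<in> strands b" "z \<in> curve m s" by blast
          with * obtain v where "v \<in> {1..m}" "ends s \<subseteq> orb v" by metis
          with s show ?thesis unfolding subpicture_def by blast
        qed
      qed
      then obtain v where v: "v \<in> {1..m}" "z \<in> subpicture (orb v)" by blast
      then have "C = subpicture (orb v)" using comp[OF v(1)] z(2) connected_component_eq by metis
      then show "C \<in> (\<lambda>v. subpicture (orb v)) ` {1..m}" using v by blast
    qed
    show "(\<lambda>v. subpicture (orb v)) ` {1..m} \<subseteq> components (circle_diagram m a b)"
    proof
      fix C assume "C \<in> (\<lambda>v. subpicture (orb v)) ` {1..m}"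
      then obtain v where v: "v \<in> {1..m}" "C = subpicture (orb v)" by blast
      have "invariant {1..m}" using invariant_Diff[of "{}"] by (simp add: invariant_def)
      then have "vertex v \<in> subpicture {1..m}" using vertex_in_subpicture v by simp
      then show "C \<in> components (circle_diagram m a b)"
        using comp[OF v(1)] v(2) unfolding circle_diagram_eq components_def by blast
    qed
  qed
qed

section \<open>Dictionary between components and orbits\<close>

definition closed_orbit :: "nat set \<Rightarrow> bool" where
  "closed_orbit K \<longleftrightarrow> (\<forall>v\<in>K. mate a v \<noteq> v \<and> mate b v \<noteq> v)"

text \<open>Exactly the rays reach height \<open>m\<close> in absolute value:
  \<open>Im_Cup_bound\<close> keeps the cups away from both horizontal edges.\<close>

lemma closed_component_subpicture:
  assumes K: "invariant K"
  shows "closed_component m (subpicture K) \<longleftrightarrow> closed_orbit K"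
proof
  assume cl: "closed_component m (subpicture K)"
  show "closed_orbit K"
    unfolding closed_orbit_def
  proof (intro ballI conjI)
    fix v assume v: "v \<in> K"
    then have vm: "v \<in> {1..m}" using K by (auto simp: invariant_def)
    show "mate a v \<noteq> v"
    proof
      assume "mate a v = v"
      then have "Ray v \<in> strands a" using vm a.Ray_iff by simp
      then have "cnj ` curve m (Ray v) \<subseteq> subpicture K" using curve_subset_subpicture_a[OF K] v by simp
      moreover have "Complex v (- real m) \<in> curve m (Ray v)" by (simp add: curve_Ray_iff)
      ultimately have "cnj (Complex v (- real m)) \<in> subpicture K" by blast
      then show False using cl unfolding closed_component_def by fastforce
    qed
    show "mate b v \<noteq> v"
    proof
      assume "mate b v = v"
      then have "Ray v \<in> strands b" using vm b.Ray_iff by simp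
      then have "curve m (Ray v) \<subseteq> subpicture K" using curve_subset_subpicture_b[OF K] v by simp
      moreover have "Complex v (- real m) \<in> curve m (Ray v)" by (simp add: curve_Ray_iff)
      ultimately have "Complex v (- real m) \<in> subpicture K" by blast
      then show False using cl unfolding closed_component_def by fastforce
    qed
  qed
next
  assume cl: "closed_orbit K"
  have bound: "\<bar>Im z\<bar> \<noteq> real m" if z: "z \<in> curve m s" and s: "ends s \<subseteq> K" and
    d: "s \<in> strands a \<or> s \<in> strands b" for z s
  proof (cases s)
    case (Cup i j)
    then have "- real m < Im z" "Im z \<le> 0"
      using z d a.Im_Cup_bound b.Im_Cup_bound a.Im_curve b.Im_curve by blast+
    then show ?thesis by simp
  next
    case (Ray i)
    then show ?thesis using s d cl a.mate_Ray[of i] b.mate_Ray[of i] by (auto simp: closed_orbit_def)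
  qed
  show "closed_component m (subpicture K)"
    unfolding closed_component_def
  proof
    fix z assume "z \<in> subpicture K"
    then consider s where "s \<in> strands a" "ends s \<subseteq> K" "z \<in> cnj ` curve m s"
      | s where "s \<in> strands b" "ends s \<subseteq> K" "z \<in> curve m s"
      unfolding subpicture_def by blast
    then show "\<bar>Im z\<bar> \<noteq> real m"
    proof cases
      case 1
      then obtain w where "w \<in> curve m s" "z = cnj w" by blast
      then show ?thesis using bound[of w s] 1 by simp
    next
      case 2
      then show ?thesis using bound[of z s] by simp
    qed
  qed
qed

lemma num_dots_subpicture:
  assumes "invariant K"
  shows "num_dots m a b (subpicture K) = dots a K + dots b K"
proof -
  have "{s \<in> dotted a. cnj ` curve m s \<subseteq> subpicture K} = {s \<in> dotted a. ends s \<subseteq> K}"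
    "{s \<in> dotted b. curve m s \<subseteq> subpicture K} = {s \<in> dotted b. ends s \<subseteq> K}"
    using a.dotted_subset b.dotted_subset curve_subset_subpicture_a[OF assms] curve_subset_subpicture_b[OF assms]
    by blast+
  then show ?thesis by (simp add: num_dots_def dots_def)
qed

lemma propagating_subpicture:
  assumes K: "invariant K"
  shows "propagating m a b (subpicture K) \<longleftrightarrow> (\<exists>i\<in>K. mate a i = i) \<and> (\<exists>i\<in>K. mate b i = i)"
proof -
  have "K \<subseteq> {1..m}" using K by (simp add: invariant_def)
  then have "Ray i \<in> strands a \<and> cnj ` curve m (Ray i) \<subseteq> subpicture K \<longleftrightarrow> i \<in> K \<and> mate a i = i"
    "Ray i \<in> strands b \<and> curve m (Ray i) \<subseteq> subpicture K \<longleftrightarrow> i \<in> K \<and> mate b i = i" for i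
    using curve_subset_subpicture_a[OF K, of "Ray i"] curve_subset_subpicture_b[OF K, of "Ray i"]
      a.Ray_iff[of i] b.Ray_iff[of i]
    by (smt (verit) ends.simps(2) empty_subsetI insert_subset subsetD)+
  then show ?thesis unfolding propagating_def by blast
qed

lemma circ_eq: "circ m a b = card {K \<in> orb ` {1..m}. closed_orbit K}"
proof -
  have inj: "inj_on subpicture (orb ` {1..m})"
  proof (rule inj_onI)
    fix K L assume "K \<in> orb ` {1..m}" "L \<in> orb ` {1..m}" and eq: "subpicture K = subpicture L"
    then have "invariant K" "invariant L" using invariant_orb by auto
    then show "K = L" using eq vertex_in_subpicture by (metis subsetI subset_antisym)
  qed
  have "{C \<in> components (circle_diagram m a b). closed_component m C}
      = subpicture ` {K \<in> orb ` {1..m}. closed_orbit K}"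
    unfolding components_eq using closed_component_subpicture[OF invariant_orb] by auto
  then show ?thesis
    unfolding circ_def by (simp add: card_image inj_on_subset[OF inj])
qed

end

section \<open>Necessity of the conditions\<close>

lemma norm_pole_p: "norm pole_p = 1" and norm_point_q: "norm point_q = 1"
  by (simp_all add: norm_eq_1 inner_vec_def sum_3 pole_p_def point_q_def vector_3)

lemma pole_p_neq_point_q: "pole_p \<noteq> point_q" "- pole_p \<noteq> point_q"
proof -
  have "pole_p $ 1 = 0" "point_q $ 1 = 1"
    by (simp_all add: pole_p_def point_q_def vector_3)
  then show "pole_p \<noteq> point_q" "- pole_p \<noteq> point_q"
    by (metis zero_neq_one vector_uminus_component neg_equal_0_iff_equal)+
qed

lemma norm_ray_value: "norm (ray_value d v) = 1"
  by (simp add: ray_value_def norm_pole_p norm_point_q)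

context cup_diag
begin

lemma ray_value_cases:
  "rightmost_ray d v \<Longrightarrow> ray_value d v = (if Ray v \<in> dotted d then 1 else - 1) *\<^sub>R pole_p"
  "\<not> rightmost_ray d v \<Longrightarrow> ray_value d v = point_q"
  "\<not> rightmost_ray d v \<Longrightarrow> Ray v \<notin> dotted d"
  using dotted_Ray_rightmost by (auto simp: ray_value_def)

section \<open>Parity of the vertices of a set to the left of a strand\<close>

lemma even_card_mate:
  assumes "finite X" "mate d ` X \<subseteq> X"
  shows "even (card X) \<longleftrightarrow> even (card {v \<in> X. mate d v = v})"
  using card_involution[OF mate_mate assms(2,1)] by simp

text \<open>The vertices of \<open>L\<close> strictly between the ends of a cup are paired off by
  \<open>mate d\<close>, so their number is even. Following a strand outside \<open>L\<close>
  therefore never changes sides.\<close>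

lemma even_card_left_of_mate:
  assumes L: "finite L" "mate d ` L \<subseteq> L" and v: "v \<in> {1..m}" "v \<notin> L"
  shows "even (card {w \<in> L. w < mate d v}) \<longleftrightarrow> even (card {w \<in> L. w < v})"
proof -
  have *: "even (card {w \<in> L. w < j}) \<longleftrightarrow> even (card {w \<in> L. w < i})"
    if ij: "Cup i j \<in> strands d" and i: "i \<notin> L" for i j
  proof -
    let ?X = "{w \<in> L. i < w \<and> w < j}"
    have "{w \<in> L. w < j} = {w \<in> L. w < i} \<union> ?X"
      using Cup_less[OF ij] i by (auto, metis linorder_neqE_nat)
    moreover have "card ({w \<in> L. w < i} \<union> ?X) = card {w \<in> L. w < i} + card ?X"
      using L by (intro card_Un_disjoint) auto
    moreover have "mate d ` ?X \<subseteq> ?X" using L mate_between[OF ij] by auto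
    then have "even (card ?X) \<longleftrightarrow> even (card {w \<in> ?X. mate d w = w})"
      using L by (intro even_card_mate) auto
    moreover have no_fix: "{w \<in> ?X. mate d w = w} = {}" using mate_between(1)[OF ij] by auto
    ultimately show ?thesis unfolding no_fix by simp
  qed
  have m: "mate d v \<notin> L"
  proof
    assume "mate d v \<in> L"
    then have "mate d (mate d v) \<in> L" using L by blast
    then show False using v by simp
  qed
  show ?thesis
    using v(1)
  proof (cases rule: mate_cases)
    case 1
    then show ?thesis using *[OF 1(1) v(2)] by simp
  next
    case 2
    then show ?thesis using *[OF 2(1) m] by simp
  qed simp
qed

text \<open>To the left of a ray all vertices of \<open>L\<close> other than \<open>r\<close> are
  paired off, so the parity records whether \<open>r\<close> lies there.\<close>

lemma even_card_left_of_Ray: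
  assumes L: "finite L" "mate d ` L \<subseteq> L" and fixed: "{w \<in> L. mate d w = w} = {r}"
    and i: "Ray i \<in> strands d" "i \<notin> L"
  shows "even (card {w \<in> L. w < i}) \<longleftrightarrow> i < r"
proof -
  let ?X = "{w \<in> L. w < i}"
  have "mate d ` ?X \<subseteq> ?X" using L mate_left_of_Ray[OF i(1)] by auto
  then have "even (card ?X) \<longleftrightarrow> even (card {w \<in> ?X. mate d w = w})"
    using L by (intro even_card_mate) auto
  moreover have "{w \<in> ?X. mate d w = w} = (if r < i then {r} else {})" using fixed by auto
  moreover have "r \<noteq> i" using fixed i by auto
  ultimately show ?thesis by auto
qed

text \<open>Rays lie to the left of every dotted cup, hence so does \<open>r\<close>, while the
  other vertices of \<open>L\<close> to the left of \<open>i\<close> are paired off among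
  themselves.\<close>

lemma odd_card_left_of_dotted_Cup:
  assumes L: "finite L" "mate d ` L \<subseteq> L" and fixed: "{w \<in> L. mate d w = w} = {r}"
    and r: "Ray r \<in> strands d" and ij: "Cup i j \<in> dotted d"
  shows "odd (card {w \<in> L. w < i})"
proof -
  let ?X = "{w \<in> L. w < i}"
  have "mate d ` ?X \<subseteq> ?X" using L mate_left_of_dotted[OF ij] by auto
  then have "even (card ?X) \<longleftrightarrow> even (card {w \<in> ?X. mate d w = w})"
    using L by (intro even_card_mate) auto
  moreover have "{w \<in> ?X. mate d w = w} = {r}" using fixed Ray_left_of_dotted_Cup[OF ij r] by auto
  ultimately show ?thesis by simp
qed

lemma rightmost_ray_exists:
  assumes "Ray i \<in> strands d"
  shows "\<exists>r. rightmost_ray d r"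
proof -
  let ?R = "{r. Ray r \<in> strands d}"
  have "?R \<subseteq> {1..m}" using Ray_iff by auto
  then have fin: "finite ?R" using finite_subset by blast
  have "rightmost_ray d (Max ?R)"
    unfolding rightmost_ray_def using Max_in[OF fin] Max_ge[OF fin] assms by blast
  then show ?thesis by blast
qed

end

lemma rightmost_ray_unique: "rightmost_ray d i \<Longrightarrow> rightmost_ray d j \<Longrightarrow> i = j"
  unfolding rightmost_ray_def by (meson le_antisym)

context circle_pair
begin

lemma swap: "circle_pair m b a"
  by (intro circle_pair.intro a.cup_diag_axioms b.cup_diag_axioms)

abbreviation ends_a :: "nat set \<Rightarrow> nat set" where
  "ends_a K \<equiv> {v \<in> K. mate a v = v}"

abbreviation ends_b :: "nat set \<Rightarrow> nat set" where
  "ends_b K \<equiv> {v \<in> K. mate b v = v}"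

abbreviation sgn_on :: "nat set \<Rightarrow> (nat \<Rightarrow> real) \<Rightarrow> bool" where
  "sgn_on K s \<equiv> signing (mate a) (edge_sign a) (mate b) (edge_sign b) K s"

lemma orb_eq: "v \<in> orb u \<Longrightarrow> orb v = orb u"
  by (rule orbit2_eq) simp_all

lemma orb_disjoint: "u \<notin> orb v \<Longrightarrow> orb u \<inter> orb v = {}"
  using orb_eq by (metis disjoint_iff orbit2.base)

lemma orbE:
  assumes "u \<in> {1..m}" "v \<in> orb u"
  shows "v \<in> {1..m}"
  using invariant_orb[OF assms(1)] assms(2) unfolding invariant_def by (meson subsetD)

lemma finite_orb: "u \<in> {1..m} \<Longrightarrow> finite (orb u)"
  using invariant_orb finite_invariant by blast

lemma card_orb:
  assumes "u \<in> {1..m}"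
  shows "card (orb u) = 2 * card {v \<in> orb u. v < mate a v} + card (ends_a (orb u))"
    "card (orb u) = 2 * card {v \<in> orb u. v < mate b v} + card (ends_b (orb u))"
  using finite_orb[OF assms] by (auto intro!: card_involution)

text \<open>Both sides evaluate \<open>prod s (orb u)\<close>, one through the pairs of
  \<open>a\<close> and the other through the pairs of \<open>b\<close>.\<close>

lemma balance:
  assumes u: "u \<in> {1..m}" and s: "sgn_on (orb u) s"
  shows "(- 1) ^ (card {v \<in> orb u. v < mate a v} + card (dotted_cups a (orb u))) * prod s (ends_a (orb u)) =
    (- 1) ^ (card {v \<in> orb u. v < mate b v} + card (dotted_cups b (orb u))) * prod s (ends_b (orb u))"
proof -
  note fin = finite_orb[OF u]
  have "prod s (orb u) = total_sign (mate a) (edge_sign a) (orb u) * prod s (ends_a (orb u))"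
    by (rule total_sign_signing[OF a.sign_change_mate s _ fin]) auto
  moreover have "prod s (orb u) = total_sign (mate b) (edge_sign b) (orb u) * prod s (ends_b (orb u))"
    by (rule total_sign_signing[OF b.sign_change_mate s[unfolded signing_commute[of "mate a"]] _ fin]) auto
  ultimately show ?thesis by (simp only: a.total_sign_mate[OF fin] b.total_sign_mate[OF fin])
qed

lemma card_ends:
  assumes u: "u \<in> {1..m}" and "\<not> closed_orbit (orb u)"
  shows "card (ends_a (orb u)) + card (ends_b (orb u)) = 2"
proof -
  obtain r where r: "r \<in> orb u" "mate a r = r \<or> mate b r = r"
    using assms(2) unfolding closed_orbit_def by blast
  have eq: "orb r = orb u" by (rule orb_eq[OF r(1)])
  have fin: "finite (orb r)" using finite_orb[OF u] eq by simp
  from r(2) show ?thesis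
  proof
    assume "mate a r = r"
    from card_fixed_points_orbit2[OF _ _ this fin] show ?thesis by (simp add: eq)
  next
    assume "mate b r = r"
    from card_fixed_points_orbit2[OF _ _ this fin[unfolded orbit2_commute[of "mate a"]]]
    show ?thesis by (simp add: eq orbit2_commute[of "mate b"])
  qed
qed

lemma dots_orb:
  assumes "u \<in> {1..m}"
  shows "dots a (orb u) = card (dotted_cups a (orb u)) + card {v \<in> orb u. Ray v \<in> dotted a}"
    "dots b (orb u) = card (dotted_cups b (orb u)) + card {v \<in> orb u. Ray v \<in> dotted b}"
  using invariant_orb[OF assms] a.dots_eq b.dots_eq unfolding invariant_def by blast+

text \<open>A combinatorial Jordan curve statement: an orbit outside \<open>L\<close> never crosses
  \<open>L\<close>, because each of its strands preserves the parity to the left.\<close>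

lemma side_constant_on_orb:
  assumes L: "invariant L" and u: "u \<in> {1..m}" "u \<notin> L" and v: "v \<in> orb u"
  shows "v \<notin> L \<and> (even (card {w \<in> L. w < v}) \<longleftrightarrow> even (card {w \<in> L. w < u}))"
  using v
proof induction
  case (left v)
  have "mate a ` L \<subseteq> L" using L by (simp add: invariant_def)
  moreover have "mate a v \<notin> L"
  proof
    assume "mate a v \<in> L"
    then have "mate a (mate a v) \<in> L" using L unfolding invariant_def by blast
    then show False using left.IH by simp
  qed
  ultimately show ?case
    using a.even_card_left_of_mate[OF finite_invariant[OF L] _ orbE[OF u(1) left.hyps]] left.IH by blast
next
  case (right v)
  have "mate b ` L \<subseteq> L" using L by (simp add: invariant_def)
  moreover have "mate b v \<notin> L"
  proof
    assume "mate b v \<in> L"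
    then have "mate b (mate b v) \<in> L" using L unfolding invariant_def by blast
    then show False using right.IH by simp
  qed
  ultimately show ?case
    using b.even_card_left_of_mate[OF finite_invariant[OF L] _ orbE[OF u(1) right.hyps]] right.IH by blast
qed (use u in auto)

text \<open>
  Planarity: a propagating line separates the rectangle, and the parity of the number of its
  vertices to the left of v tells on which side v lies.
\<close>
lemma propagating_line_order:
  assumes L: "invariant L" "ends_a L = {r}" "ends_b L = {s}"
    and u: "u \<in> {1..m}" "u \<notin> L"
    and i: "i \<in> orb u" "mate a i = i" and j: "j \<in> orb u" "mate b j = j"
  shows "i < r \<longleftrightarrow> j < s"
proof -
  note fin = finite_invariant[OF L(1)]
  note side = side_constant_on_orb[OF L(1) u]
  have sub: "mate a ` L \<subseteq> L" "mate b ` L \<subseteq> L" using L(1) by (auto simp: invariant_def)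
  have "Ray i \<in> strands a" "Ray j \<in> strands b"
    using a.Ray_iff b.Ray_iff orbE[OF u(1)] i j by auto
  then show ?thesis
    using a.even_card_left_of_Ray[OF fin sub(1) L(2)] b.even_card_left_of_Ray[OF fin sub(2) L(3)]
      side[OF i(1)] side[OF j(1)] by blast
qed

text \<open>An end of the other line is a ray to the left of a rightmost ray, which places the whole
  orbit on the even side of \<open>L\<close>. Dotted cups lie on the odd side.\<close>

lemma no_dotted_cups_left_of_line:
  assumes L: "invariant L" "ends_a L = {r}" "ends_b L = {s}"
    and r: "rightmost_ray a r" and s: "rightmost_ray b s"
    and u: "u \<in> {1..m}" "u \<notin> L" and line: "\<not> closed_orbit (orb u)"
  shows "dotted_cups a (orb u) = {}" "dotted_cups b (orb u) = {}"
proof -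
  note fin = finite_invariant[OF L(1)]
  note side = side_constant_on_orb[OF L(1) u]
  have sub: "mate a ` L \<subseteq> L" "mate b ` L \<subseteq> L" using L(1) by (auto simp: invariant_def)
  have rs: "Ray r \<in> strands a" "Ray s \<in> strands b" using r s by (auto simp: rightmost_ray_def)
  obtain i where i: "i \<in> orb u" "mate a i = i \<or> mate b i = i"
    using line unfolding closed_orbit_def by blast
  have even: "even (card {w \<in> L. w < i})"
    using i(2)
  proof
    assume "mate a i = i"
    then have Ri: "Ray i \<in> strands a" using a.Ray_iff orbE[OF u(1) i(1)] by simp
    moreover have "i \<noteq> r" using side[OF i(1)] L(2) by blast
    ultimately have "i < r" using r unfolding rightmost_ray_def by (simp add: order.not_eq_order_implies_strict)
    then show ?thesis using a.even_card_left_of_Ray[OF fin sub(1) L(2) Ri] side[OF i(1)] by blast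
  next
    assume "mate b i = i"
    then have Ri: "Ray i \<in> strands b" using b.Ray_iff orbE[OF u(1) i(1)] by simp
    moreover have "i \<noteq> s" using side[OF i(1)] L(3) by blast
    ultimately have "i < s" using s unfolding rightmost_ray_def by (simp add: order.not_eq_order_implies_strict)
    then show ?thesis using b.even_card_left_of_Ray[OF fin sub(2) L(3) Ri] side[OF i(1)] by blast
  qed
  then have even': "even (card {w \<in> L. w < v})" if "v \<in> orb u" for v
    using side[OF i(1)] side[OF that] by blast
  show "dotted_cups a (orb u) = {}"
    using a.odd_card_left_of_dotted_Cup[OF fin sub(1) L(2) rs(1)] even' unfolding dotted_cups_def by blast
  show "dotted_cups b (orb u) = {}"
    using b.odd_card_left_of_dotted_Cup[OF fin sub(2) L(3) rs(2)] even' unfolding dotted_cups_def by blast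
qed

section \<open>Coordinates of a common point along an orbit\<close>

abbreviation "S_both \<equiv> S_space m a \<inter> S_space m b"

lemma S_both_norm:
  assumes "x \<in> S_both" "v \<in> {1..m}"
  shows "norm (x v) = 1"
proof -
  have "x \<in> topspace (sphere_power {1..m})" using assms(1) a.S_space_iff by blast
  then show ?thesis using assms(2) by (auto simp: sphere_power_def PiE_iff)
qed

lemma S_both_mate:
  assumes "x \<in> S_both" "v \<in> {1..m}"
  shows "x (mate a v) = edge_sign a v *\<^sub>R x v" "x (mate b v) = edge_sign b v *\<^sub>R x v"
  using assms a.S_space_iff b.S_space_iff by blast+

lemma S_both_ray:
  assumes "x \<in> S_both"
  shows "Ray v \<in> strands a \<Longrightarrow> x v = ray_value a v" "Ray v \<in> strands b \<Longrightarrow> x v = ray_value b v"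
  using assms a.S_space_iff b.S_space_iff by blast+

text \<open>All coordinates on the orbit are plus or minus the unit vector \<open>x u\<close>, so
  the inner product with \<open>x u\<close> reads off the sign.\<close>

lemma S_both_signing:
  assumes x: "x \<in> S_both" and u: "u \<in> {1..m}"
  shows "sgn_on (orb u) (\<lambda>v. x v \<bullet> x u)"
proof -
  have pm: "x v = x u \<or> x v = - x u" if "v \<in> orb u" for v
    using that
  proof induction
    case (left v)
    have "edge_sign a v = 1 \<or> edge_sign a v = - 1" by (simp add: edge_sign_def)
    then show ?case using left.IH S_both_mate(1)[OF x orbE[OF u left.hyps]] by auto
  next
    case (right v)
    have "edge_sign b v = 1 \<or> edge_sign b v = - 1" by (simp add: edge_sign_def)
    then show ?case using right.IH S_both_mate(2)[OF x orbE[OF u right.hyps]] by auto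
  qed simp
  have "x u \<bullet> x u = 1" using S_both_norm[OF x u] by (simp add: norm_eq_1)
  then show ?thesis
    unfolding signing_def
    using pm S_both_mate[OF x orbE[OF u]] by (auto simp: inner_left_distrib) (metis inner_minus_left)+
qed

lemma signing_determines:
  assumes x: "x \<in> S_both" and u: "u \<in> {1..m}" and s: "sgn_on (orb u) s" "s u = 1" and v: "v \<in> orb u"
  shows "x v = s v *\<^sub>R x u"
  using v
proof induction
  case (left v)
  then show ?case using S_both_mate(1)[OF x orbE[OF u left.hyps]] s(1) by (simp add: signing_def)
next
  case (right v)
  then show ?case using S_both_mate(2)[OF x orbE[OF u right.hyps]] s(1) by (simp add: signing_def)
qed (simp add: s)

lemma S_both_eq:
  assumes x: "x \<in> S_both" and u: "u \<in> {1..m}" and v: "v \<in> orb u"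
  shows "x v = x u \<or> x v = - x u"
proof -
  have "x u \<bullet> x u = 1" using S_both_norm[OF x u] by (simp add: norm_eq_1)
  then have "x v = (x v \<bullet> x u) *\<^sub>R x u"
    by (intro signing_determines[OF x u S_both_signing[OF x u] _ v])
  moreover have "x v \<bullet> x u = 1 \<or> x v \<bullet> x u = - 1"
    using S_both_signing[OF x u] v by (auto simp: signing_def)
  ultimately show ?thesis by (metis scaleR_minus1_left scaleR_one)
qed

text \<open>A further end in \<open>a\<close> on this orbit would have value q, which is neither p
  nor -p. The count of two then leaves exactly one end in \<open>b\<close>; its value is again p or
  -p, so it cannot be a ray with value q.\<close>

lemma rightmost_line:
  assumes x: "x \<in> S_both" and r: "rightmost_ray a r"
  shows "\<exists>s. ends_a (orb r) = {r} \<and> ends_b (orb r) = {s} \<and> rightmost_ray b s"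
proof -
  have Rr: "Ray r \<in> strands a" using r by (simp add: rightmost_ray_def)
  then have rm: "r \<in> {1..m}" "mate a r = r" using a.Ray_iff by auto
  have xr: "x r = pole_p \<or> x r = - pole_p"
    using S_both_ray(1)[OF x Rr] a.ray_value_cases(1)[OF r] by auto
  have only_a: "v = r" if v: "v \<in> ends_a (orb r)" for v
  proof (rule ccontr)
    assume ne: "v \<noteq> r"
    have "Ray v \<in> strands a" using v a.Ray_iff orbE[OF rm(1)] by simp
    moreover have "\<not> rightmost_ray a v" using ne r rightmost_ray_unique by blast
    ultimately have "x v = point_q" using S_both_ray(1)[OF x] a.ray_value_cases(2) by simp
    moreover have "x v = x r \<or> x v = - x r" using S_both_eq[OF x rm(1)] v by blast
    ultimately show False using xr pole_p_neq_point_q by (metis minus_minus)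
  qed
  have r_in: "r \<in> ends_a (orb r)" using rm by simp
  have A: "ends_a (orb r) = {r}" using only_a r_in by blast
  have "\<not> closed_orbit (orb r)" using rm orbit2.base unfolding closed_orbit_def by blast
  from card_ends[OF rm(1) this] have "card (ends_b (orb r)) = 1" unfolding A by simp
  then obtain s where B: "ends_b (orb r) = {s}" by (auto simp: card_1_singleton_iff)
  then have s: "s \<in> orb r" "mate b s = s" by auto
  have Rs: "Ray s \<in> strands b" using s b.Ray_iff orbE[OF rm(1)] by simp
  have "rightmost_ray b s"
  proof (rule ccontr)
    assume "\<not> rightmost_ray b s"
    then have "x s = point_q" using S_both_ray(2)[OF x Rs] b.ray_value_cases(2) by simp
    then show False using xr S_both_eq[OF x rm(1) s(1)] pole_p_neq_point_q by (metis minus_minus)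
  qed
  then show ?thesis using A B by blast
qed

lemma ends_a_subset: "u \<in> {1..m} \<Longrightarrow> v \<in> ends_a (orb u) \<Longrightarrow> Ray v \<in> strands a"
  and ends_b_subset: "u \<in> {1..m} \<Longrightarrow> v \<in> ends_b (orb u) \<Longrightarrow> Ray v \<in> strands b"
  using a.Ray_iff b.Ray_iff orbE by blast+

lemma dotted_rays_orb:
  assumes "u \<in> {1..m}"
  shows "{v \<in> orb u. Ray v \<in> dotted a} = {v \<in> ends_a (orb u). Ray v \<in> dotted a}"
    "{v \<in> orb u. Ray v \<in> dotted b} = {v \<in> ends_b (orb u). Ray v \<in> dotted b}"
  using a.mate_Ray b.mate_Ray a.dotted_subset b.dotted_subset by blast+

lemma necessity_line:
  assumes x: "x \<in> S_both" and r: "rightmost_ray a r"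
    and u: "u \<in> {1..m}" and line: "\<not> closed_orbit (orb u)"
  shows "even (dots a (orb u) + dots b (orb u))" "ends_a (orb u) \<noteq> {}" "ends_b (orb u) \<noteq> {}"
proof -
  obtain s where A: "ends_a (orb r) = {r}" and B: "ends_b (orb r) = {s}" and s: "rightmost_ray b s"
    using rightmost_line[OF x r] by blast
  have rm: "r \<in> {1..m}" using r a.Ray_iff by (simp add: rightmost_ray_def)
  have "even (dots a (orb u) + dots b (orb u)) \<and> ends_a (orb u) \<noteq> {} \<and> ends_b (orb u) \<noteq> {}"
  proof (cases "u \<in> orb r")
    \<comment> \<open>The line through the rightmost rays: both diagrams contribute one end and
      equally many cups, so \<open>balance\<close> compares the dotted cups with the dots on the two
      rays.\<close>
    case True
    then have eq: "orb u = orb r" by (rule orb_eq)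
    let ?s = "\<lambda>v. x v \<bullet> x r"
    have cups: "card {v \<in> orb r. v < mate a v} = card {v \<in> orb r. v < mate b v}"
      using card_orb[OF rm] unfolding A B by simp
    have Rr: "Ray r \<in> strands a" and Rs: "Ray s \<in> strands b"
      using r s by (auto simp: rightmost_ray_def)
    have xr: "x r = (if Ray r \<in> dotted a then 1 else - 1) *\<^sub>R pole_p"
      using S_both_ray(1)[OF x Rr] a.ray_value_cases(1)[OF r] by simp
    have xs: "x s = (if Ray s \<in> dotted b then 1 else - 1) *\<^sub>R pole_p"
      using S_both_ray(2)[OF x Rs] b.ray_value_cases(1)[OF s] by simp
    have "pole_p \<bullet> pole_p = 1" using norm_pole_p by (simp add: norm_eq_1)
    then have sr: "?s r = 1" and ss: "?s s = (if Ray s \<in> dotted b \<longleftrightarrow> Ray r \<in> dotted a then 1 else - 1)"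
      unfolding xr xs by auto
    have bal: "(- 1 :: real) ^ card (dotted_cups a (orb r)) =
        (- 1) ^ card (dotted_cups b (orb r)) * (if Ray s \<in> dotted b \<longleftrightarrow> Ray r \<in> dotted a then 1 else - 1)"
      using balance[OF rm S_both_signing[OF x rm]] unfolding A B cups by (simp add: power_add sr ss)
    have da: "card {v \<in> orb r. Ray v \<in> dotted a} = (if Ray r \<in> dotted a then 1 else 0)"
      and db: "card {v \<in> orb r. Ray v \<in> dotted b} = (if Ray s \<in> dotted b then 1 else 0)"
      unfolding dotted_rays_orb[OF rm] A B by (auto simp: card_1_singleton_iff)
    have "even (dots a (orb r) + dots b (orb r))"
      using bal unfolding dots_orb[OF rm] da db
      by (auto simp: minus_one_power_iff split: if_splits)
    then show ?thesis unfolding eq A B by simp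
  next
    \<comment> \<open>Every other line carries no dots and has the value q at each of its ends, so
      all signs at its ends agree.\<close>
    case False
    note D = no_dotted_cups_left_of_line[OF invariant_orb[OF rm] A B r s u False line]
    have q: "x v = point_q \<and> Ray v \<notin> dotted a" if v: "v \<in> ends_a (orb u)" for v
    proof -
      have "v \<notin> orb r" using v orb_disjoint[OF False] by blast
      then have "\<not> rightmost_ray a v" using r rightmost_ray_unique orbit2.base by metis
      then show ?thesis
        using S_both_ray(1)[OF x ends_a_subset[OF u v]] a.ray_value_cases(2,3) by simp
    qed
    have q': "x v = point_q \<and> Ray v \<notin> dotted b" if v: "v \<in> ends_b (orb u)" for v
    proof -
      have "s \<in> orb r" using B by blast
      then have "v \<noteq> s" using v orb_disjoint[OF False] by blast
      then have "\<not> rightmost_ray b v" using s rightmost_ray_unique by metis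
      then show ?thesis
        using S_both_ray(2)[OF x ends_b_subset[OF u v]] b.ray_value_cases(2,3) by simp
    qed
    have no_dots: "dots a (orb u) = 0" "dots b (orb u) = 0"
      unfolding dots_orb[OF u] dotted_rays_orb[OF u] D using q q' by (auto simp: card_eq_0_iff)
    obtain w where w: "w \<in> ends_a (orb u) \<union> ends_b (orb u)"
      using line unfolding closed_orbit_def by blast
    then have wu: "w \<in> orb u" by blast
    have wm: "w \<in> {1..m}" by (rule orbE[OF u wu])
    have eq: "orb w = orb u" by (rule orb_eq[OF wu])
    have xw: "x w = point_q" using w q q' by blast
    have "point_q \<bullet> point_q = 1" using norm_point_q by (simp add: norm_eq_1)
    then have prods: "prod (\<lambda>v. x v \<bullet> x w) (ends_a (orb u)) = 1" "prod (\<lambda>v. x v \<bullet> x w) (ends_b (orb u)) = 1"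
      using q q' xw by (auto intro!: prod.neutral)
    have bal: "(- 1 :: real) ^ card {v \<in> orb u. v < mate a v} = (- 1) ^ card {v \<in> orb u. v < mate b v}"
      using balance[OF wm S_both_signing[OF x wm]] unfolding eq D prods by simp
    have "card (ends_a (orb u)) \<noteq> 0 \<and> card (ends_b (orb u)) \<noteq> 0"
    proof -
      have par: "even (card {v \<in> orb u. v < mate a v}) \<longleftrightarrow> even (card {v \<in> orb u. v < mate b v})"
        using bal by (auto simp: minus_one_power_iff split: if_splits)
      \<comment> \<open>Modulo 4: the two expressions for \<open>c\<close> give f - g = 2 * (q - p),
        a multiple of 4 because \<open>p\<close> and \<open>q\<close> have equal parity. With f + g
        = 2 this leaves f = g = 1.\<close>
      have "f \<noteq> 0 \<and> g \<noteq> 0"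
        if "even p \<longleftrightarrow> even q" "c = 2 * p + f" "c = 2 * q + g" "f + g = 2" for p q c f g :: nat
        using that by presburger
      from this[OF par card_orb[OF u] card_ends[OF u line]] show ?thesis .
    qed
    then show ?thesis using no_dots finite_orb[OF u] by auto
  qed
  then show "even (dots a (orb u) + dots b (orb u))" "ends_a (orb u) \<noteq> {}" "ends_b (orb u) \<noteq> {}"
    by auto
qed

lemma necessity_closed:
  assumes x: "x \<in> S_both" and u: "u \<in> {1..m}" and cl: "closed_orbit (orb u)"
  shows "even (dots a (orb u) + dots b (orb u))"
proof -
  have E: "ends_a (orb u) = {}" "ends_b (orb u) = {}" using cl unfolding closed_orbit_def by blast+
  have cups: "card {v \<in> orb u. v < mate a v} = card {v \<in> orb u. v < mate b v}"
    using card_orb[OF u] unfolding E by simp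
  have "(- 1 :: real) ^ card (dotted_cups a (orb u)) = (- 1) ^ card (dotted_cups b (orb u))"
    using balance[OF u S_both_signing[OF x u]] unfolding E cups by (simp add: power_add)
  then show ?thesis
    unfolding dots_orb[OF u] dotted_rays_orb[OF u] E by (auto simp: minus_one_power_iff split: if_splits)
qed

end

section \<open>Sufficiency and the homeomorphism\<close>

context circle_pair
begin

text \<open>A ray of \<open>b\<close> on another orbit sits on a line that also ends in
  \<open>a\<close>, necessarily to the left of \<open>r\<close>; by
  \<open>propagating_line_order\<close> it then lies to the left of \<open>s\<close>.\<close>

lemma rightmost_transfer:
  assumes through: "\<And>u. u \<in> {1..m} \<Longrightarrow> ends_b (orb u) \<noteq> {} \<Longrightarrow> ends_a (orb u) \<noteq> {}"
    and u: "u \<in> {1..m}" and A: "ends_a (orb u) = {r}" and B: "ends_b (orb u) = {s}"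
    and r: "rightmost_ray a r"
  shows "rightmost_ray b s"
  unfolding rightmost_ray_def
proof (intro conjI allI impI)
  show "Ray s \<in> strands b" using ends_b_subset[OF u] B by blast
  fix j assume "Ray j \<in> strands b"
  then have j: "j \<in> {1..m}" "mate b j = j" using b.Ray_iff by auto
  show "j \<le> s"
  proof (cases "j \<in> orb u")
    case True
    then have "j \<in> ends_b (orb u)" using j by simp
    then show ?thesis unfolding B by simp
  next
    case False
    have "ends_b (orb j) \<noteq> {}" using j orbit2.base by blast
    then obtain i where i: "i \<in> orb j" "mate a i = i" using through[OF j(1)] by blast
    have "i \<noteq> r" using A i(1) orb_disjoint[OF False] by blast
    moreover have "i \<le> r" using r i a.Ray_iff orbE[OF j(1) i(1)] unfolding rightmost_ray_def by blast
    ultimately have "i < r" by simp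
    then show ?thesis
      using propagating_line_order[OF invariant_orb[OF u] A B j(1) False i orbit2.base j(2)] by simp
  qed
qed

text \<open>On a closed orbit both diagrams have the same number of cups, so equality of the total
  signs reduces to the parity of the dots.\<close>

lemma closed_signing:
  assumes u: "u \<in> {1..m}" and cl: "closed_orbit (orb u)"
    and dots: "even (dots a (orb u) + dots b (orb u))"
  shows "\<exists>s. sgn_on (orb u) s"
proof (rule signing_exists_of_total_sign[OF a.sign_change_mate b.sign_change_mate finite_orb[OF u]])
  show "mate a v \<noteq> v \<and> mate b v \<noteq> v" if "v \<in> orb u" for v
    using cl that unfolding closed_orbit_def by blast
  have E: "ends_a (orb u) = {}" "ends_b (orb u) = {}" using cl unfolding closed_orbit_def by blast+
  have cups: "card {v \<in> orb u. v < mate a v} = card {v \<in> orb u. v < mate b v}"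
    using card_orb[OF u] unfolding E by simp
  have "even (card (dotted_cups a (orb u)) + card (dotted_cups b (orb u)))"
    using dots unfolding dots_orb[OF u] dotted_rays_orb[OF u] E by simp
  then show "total_sign (mate a) (edge_sign a) (orb u) = total_sign (mate b) (edge_sign b) (orb u)"
    unfolding a.total_sign_mate[OF finite_orb[OF u]] b.total_sign_mate[OF finite_orb[OF u]] cups
    by (auto simp: minus_one_power_iff)
qed

text \<open>The fixed point \<open>r\<close> supplies signs on the line, and \<open>balance\<close>
  relates \<open>t r\<close> and \<open>t s\<close> through the dotted cups. Evenness of the dots
  makes the two prescribed ray values agree once their signs are removed.\<close>

lemma line_solution:
  assumes u: "u \<in> {1..m}" and A: "ends_a (orb u) = {r}" and B: "ends_b (orb u) = {s}"
    and rs: "rightmost_ray a r \<longleftrightarrow> rightmost_ray b s"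
    and dots: "even (dots a (orb u) + dots b (orb u))"
  shows "\<exists>t. sgn_on (orb u) t \<and> t r *\<^sub>R ray_value a r = t s *\<^sub>R ray_value b s"
proof -
  have r: "r \<in> orb u" "mate a r = r" using A by auto
  have s: "s \<in> orb u" using B by auto
  have eq: "orb r = orb u" by (rule orb_eq[OF r(1)])
  obtain t where t: "sgn_on (orb u) t"
    using signing_exists_of_fixed_point[OF a.sign_change_mate b.sign_change_mate r(2)]
      finite_orb[OF u] unfolding eq by blast
  have cups: "card {v \<in> orb u. v < mate a v} = card {v \<in> orb u. v < mate b v}"
    using card_orb[OF u] unfolding A B by simp
  have bal: "(- 1) ^ card (dotted_cups a (orb u)) * t r = (- 1) ^ card (dotted_cups b (orb u)) * t s"
    using balance[OF u t] unfolding A B cups by (simp add: power_add)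
  have da: "card {v \<in> orb u. Ray v \<in> dotted a} = (if Ray r \<in> dotted a then 1 else 0)"
    and db: "card {v \<in> orb u. Ray v \<in> dotted b} = (if Ray s \<in> dotted b then 1 else 0)"
    unfolding dotted_rays_orb[OF u] A B by (auto simp: card_1_singleton_iff)
  have t1: "t r = 1 \<or> t r = - 1" "t s = 1 \<or> t s = - 1"
    using t r s by (auto simp: signing_def)
  have "t r *\<^sub>R ray_value a r = t s *\<^sub>R ray_value b s"
  proof (cases "rightmost_ray a r")
    case True
    then have vals: "ray_value a r = (if Ray r \<in> dotted a then 1 else - 1) *\<^sub>R pole_p"
      "ray_value b s = (if Ray s \<in> dotted b then 1 else - 1) *\<^sub>R pole_p"
      using a.ray_value_cases(1) b.ray_value_cases(1) rs by blast+
    have "t r * (if Ray r \<in> dotted a then 1 else - 1) = t s * (if Ray s \<in> dotted b then 1 else - 1)"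
      using dots bal unfolding dots_orb[OF u] da db
      by (auto simp: minus_one_power_iff split: if_splits)
    then show ?thesis unfolding vals by simp
  next
    case False
    then have vals: "ray_value a r = point_q" "ray_value b s = point_q"
      and nd: "Ray r \<notin> dotted a" "Ray s \<notin> dotted b"
      using a.ray_value_cases(2,3) b.ray_value_cases(2,3) rs by blast+
    have "t r = t s"
      using dots bal nd unfolding dots_orb[OF u] da db
      by (auto simp: minus_one_power_iff split: if_splits)
    then show ?thesis unfolding vals by simp
  qed
  then show ?thesis using t by blast
qed

text \<open>\<open>c\<close> is the base vector of the orbit: the intended point has coordinate
  \<open>s v *\<^sub>R c\<close> at each vertex \<open>v\<close> of \<open>K\<close>.\<close>

definition solves :: "nat set \<Rightarrow> (nat \<Rightarrow> real) \<Rightarrow> real ^ 3 \<Rightarrow> bool" where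
  "solves K s c \<longleftrightarrow> sgn_on K s \<and> norm c = 1 \<and>
     (\<forall>v\<in>ends_a K. s v *\<^sub>R c = ray_value a v) \<and> (\<forall>v\<in>ends_b K. s v *\<^sub>R c = ray_value b v)"

lemma S_both_nonempty:
  assumes "\<And>u. u \<in> {1..m} \<Longrightarrow> \<exists>s c. solves (orb u) s c"
  shows "S_both \<noteq> {}"
proof -
  \<comment> \<open>The choice depends on the orbit as a set, so all its vertices receive the same
    signing and the same base vector.\<close>
  define SC where "SC K = (SOME sc. solves K (fst sc) (snd sc))" for K
  have SC: "solves (orb u) (fst (SC (orb u))) (snd (SC (orb u)))" if u: "u \<in> {1..m}" for u
  proof -
    obtain s c where "solves (orb u) s c" using assms[OF u] by blast
    then have "solves (orb u) (fst (s, c)) (snd (s, c))" by simp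
    then show ?thesis unfolding SC_def by (rule someI)
  qed
  define x where "x = (\<lambda>v\<in>{1..m}. fst (SC (orb v)) v *\<^sub>R snd (SC (orb v)))"
  have xv: "x v = fst (SC (orb v)) v *\<^sub>R snd (SC (orb v))" if "v \<in> {1..m}" for v
    using that by (simp add: x_def)
  have sgn: "fst (SC (orb v)) v \<in> {1, - 1}"
    "fst (SC (orb v)) (mate a v) = edge_sign a v * fst (SC (orb v)) v"
    "fst (SC (orb v)) (mate b v) = edge_sign b v * fst (SC (orb v)) v"
    if "v \<in> {1..m}" for v
    using SC[OF that] orbit2.base[of v "mate a" "mate b"] unfolding solves_def signing_def by blast+
  have top: "x \<in> topspace (sphere_power {1..m})"
  proof -
    have "norm (x v) = 1" if "v \<in> {1..m}" for v
      using SC[OF that] sgn(1)[OF that] xv[OF that] by (auto simp: solves_def)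
    then show ?thesis by (auto simp: sphere_power_def x_def)
  qed
  have "x (mate a v) = edge_sign a v *\<^sub>R x v" if v: "v \<in> {1..m}" for v
  proof -
    have "orb (mate a v) = orb v" by (rule orb_eq) auto
    then show ?thesis using xv[OF v] xv[OF a.mate_in[OF v]] sgn(2)[OF v] by simp
  qed
  moreover have "x (mate b v) = edge_sign b v *\<^sub>R x v" if v: "v \<in> {1..m}" for v
  proof -
    have "orb (mate b v) = orb v" by (rule orb_eq) auto
    then show ?thesis using xv[OF v] xv[OF b.mate_in[OF v]] sgn(3)[OF v] by simp
  qed
  moreover have "x v = ray_value a v" if "Ray v \<in> strands a" for v
  proof -
    have v: "v \<in> {1..m}" "mate a v = v" using that a.Ray_iff by auto
    then show ?thesis using SC[OF v(1)] xv[OF v(1)] by (simp add: solves_def)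
  qed
  moreover have "x v = ray_value b v" if "Ray v \<in> strands b" for v
  proof -
    have v: "v \<in> {1..m}" "mate b v = v" using that b.Ray_iff by auto
    then show ?thesis using SC[OF v(1)] xv[OF v(1)] by (simp add: solves_def)
  qed
  ultimately have "x \<in> S_space m a" "x \<in> S_space m b"
    using top a.S_space_iff b.S_space_iff by blast+
  then show ?thesis by blast
qed

text \<open>Exchanging the diagrams yields a rightmost ray of \<open>a\<close> from one of
  \<open>b\<close>, and the converse of \<open>rightmost_transfer\<close>.\<close>

interpretation swapped: circle_pair m b a by (rule swap)

lemma necessity:
  assumes x: "x \<in> S_both" and u: "u \<in> {1..m}"
  shows "even (dots a (orb u) + dots b (orb u))"
    and "\<not> closed_orbit (orb u) \<Longrightarrow> ends_a (orb u) \<noteq> {} \<and> ends_b (orb u) \<noteq> {}"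
proof -
  have x': "x \<in> swapped.S_both" using x by blast
  have *: "even (dots a (orb u) + dots b (orb u)) \<and> ends_a (orb u) \<noteq> {} \<and> ends_b (orb u) \<noteq> {}"
    if line: "\<not> closed_orbit (orb u)"
  proof -
    obtain w where w: "w \<in> orb u" "mate a w = w \<or> mate b w = w"
      using line unfolding closed_orbit_def by blast
    from w(2) have "\<exists>r. rightmost_ray a r"
    proof
      assume "mate a w = w"
      then show ?thesis using a.rightmost_ray_exists a.Ray_iff orbE[OF u w(1)] by blast
    next
      assume "mate b w = w"
      then obtain r where "rightmost_ray b r"
        using b.rightmost_ray_exists b.Ray_iff orbE[OF u w(1)] by blast
      then show ?thesis using swapped.rightmost_line[OF x'] by blast
    qed
    then show ?thesis using necessity_line[OF x _ u line] by blast
  qed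
  then show "even (dots a (orb u) + dots b (orb u))"
    using necessity_closed[OF x u] by blast
  show "\<not> closed_orbit (orb u) \<Longrightarrow> ends_a (orb u) \<noteq> {} \<and> ends_b (orb u) \<noteq> {}" using * by blast
qed

lemma sufficiency:
  assumes dots: "\<And>u. u \<in> {1..m} \<Longrightarrow> even (dots a (orb u) + dots b (orb u))"
    and through: "\<And>u. u \<in> {1..m} \<Longrightarrow> \<not> closed_orbit (orb u) \<Longrightarrow> ends_a (orb u) \<noteq> {} \<and> ends_b (orb u) \<noteq> {}"
  shows "S_both \<noteq> {}"
proof (rule S_both_nonempty)
  fix u assume u: "u \<in> {1..m}"
  show "\<exists>s c. solves (orb u) s c"
  proof (cases "closed_orbit (orb u)")
    case True
    then have "ends_a (orb u) = {}" "ends_b (orb u) = {}" unfolding closed_orbit_def by blast+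
    \<comment> \<open>No ray prescribes a value on this orbit, so any unit vector can be the base
      vector; p is taken.\<close>
    then show ?thesis
      using closed_signing[OF u True dots[OF u]] norm_pole_p unfolding solves_def by blast
  next
    case False
    have "card (ends_a (orb u)) \<noteq> 0" "card (ends_b (orb u)) \<noteq> 0"
      using through[OF u False] finite_orb[OF u] by auto
    then have "card (ends_a (orb u)) = 1" "card (ends_b (orb u)) = 1"
      using card_ends[OF u False] by linarith+
    then obtain r s where A: "ends_a (orb u) = {r}" and B: "ends_b (orb u) = {s}"
      by (meson card_1_singletonE)
    have prop_a: "ends_a (orb v) \<noteq> {}" if "v \<in> {1..m}" "ends_b (orb v) \<noteq> {}" for v
      using through[OF that(1)] that(2) unfolding closed_orbit_def by blast
    have prop_b: "ends_b (orb v) \<noteq> {}" if "v \<in> {1..m}" "ends_a (orb v) \<noteq> {}" for v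
      using through[OF that(1)] that(2) unfolding closed_orbit_def by blast
    have "rightmost_ray a r \<longleftrightarrow> rightmost_ray b s"
    proof
      show "rightmost_ray b s" if "rightmost_ray a r"
        by (rule rightmost_transfer[OF prop_a u A B that])
      show "rightmost_ray a r" if "rightmost_ray b s"
        using swapped.rightmost_transfer[OF _ u _ _ that] prop_b A B
        unfolding orbit2_commute[of "mate b" "mate a"] by blast
    qed
    then obtain t where t: "sgn_on (orb u) t" "t r *\<^sub>R ray_value a r = t s *\<^sub>R ray_value b s"
      using line_solution[OF u A B _ dots[OF u]] by blast
    \<comment> \<open>As \<open>t r\<close> is its own inverse, this base vector gives the
      prescribed value at \<open>r\<close>; the equation in \<open>t\<close> gives it at
      \<open>s\<close> too.\<close>
    define c where "c = t r *\<^sub>R ray_value a r"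
    have rs: "r \<in> orb u" "s \<in> orb u" using A B by auto
    then have "t r \<in> {1, - 1}" "t s \<in> {1, - 1}"
      using t(1) unfolding signing_def by blast+
    then have "t r * t r = 1" "t s * t s = 1" "\<bar>t r\<bar> = 1" by auto
    then have "t r *\<^sub>R c = ray_value a r" "t s *\<^sub>R c = ray_value b s" "norm c = 1"
      unfolding c_def by (simp, simp add: t(2), simp add: norm_ray_value)
    then have "solves (orb u) t c" unfolding solves_def A B using t(1) by simp
    then show ?thesis by blast
  qed
qed

lemma existence_iff:
  "S_both \<noteq> {} \<longleftrightarrow>
     (\<forall>C\<in>components (circle_diagram m a b). even (num_dots m a b C)) \<and>
     (\<forall>C\<in>components (circle_diagram m a b). \<not> closed_component m C \<longrightarrow> propagating m a b C)"
proof -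
  have "(\<forall>C\<in>components (circle_diagram m a b). even (num_dots m a b C)) \<longleftrightarrow>
      (\<forall>u\<in>{1..m}. even (dots a (orb u) + dots b (orb u)))"
    unfolding components_eq using num_dots_subpicture[OF invariant_orb] by simp
  moreover have "(\<forall>C\<in>components (circle_diagram m a b). \<not> closed_component m C \<longrightarrow> propagating m a b C)
     \<longleftrightarrow> (\<forall>u\<in>{1..m}. \<not> closed_orbit (orb u) \<longrightarrow> ends_a (orb u) \<noteq> {} \<and> ends_b (orb u) \<noteq> {})"
  proof -
    have "propagating m a b (subpicture (orb u)) \<longleftrightarrow> ends_a (orb u) \<noteq> {} \<and> ends_b (orb u) \<noteq> {}"
      if "u \<in> {1..m}" for u
      using propagating_subpicture[OF invariant_orb[OF that]] by blast
    then show ?thesis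
      unfolding components_eq using closed_component_subpicture[OF invariant_orb] by simp
  qed
  ultimately show ?thesis using necessity sufficiency by blast
qed

end

section \<open>The homeomorphism with a power of the sphere\<close>

lemma continuous_map_scale_sphere2:
  assumes "continuous_map X (top_of_set sphere2) f" "c \<in> {1, - 1 :: real}"
  shows "continuous_map X (top_of_set sphere2) (\<lambda>x. c *\<^sub>R f x)"
proof -
  have "continuous_map (top_of_set sphere2) (top_of_set sphere2) ((*\<^sub>R) c)"
    using assms(2) by (auto intro!: continuous_intros)
  from continuous_map_compose[OF assms(1) this] show ?thesis by (simp add: o_def)
qed

context circle_pair
begin

text \<open>A chosen point \<open>x0\<close> serves as origin. Its signs relate every coordinate to
  the one at a representative of the orbit; lines are frozen at the values of \<open>x0\<close>, and
  each closed orbit leaves one free unit vector.\<close>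

lemma S_both_homeomorphic:
  assumes "S_both \<noteq> {}"
  shows "subtopology (sphere_power {1..m}) S_both homeomorphic_space sphere_power {..<circ m a b}"
proof -
  obtain x0 where x0: "x0 \<in> S_both" using assms by blast
  define W where "W = {K \<in> orb ` {1..m}. closed_orbit K}"
  have "finite W" by (simp add: W_def)
  then obtain h where h: "bij_betw h {..<circ m a b} W"
    using ex_bij_betw_nat_finite[of W] unfolding circ_eq W_def[symmetric] lessThan_atLeast0 by blast
  define g where "g = inv_into {..<circ m a b} h"
  have hW: "h c \<in> W" if "c < circ m a b" for c using h that by (auto simp: bij_betw_def)
  have gh: "g (h c) = c" if "c < circ m a b" for c
    using h that by (simp add: g_def bij_betw_inv_into_left)
  have g: "g K < circ m a b \<and> h (g K) = K" if "K \<in> W" for K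
    using h that inv_into_into[of K h "{..<circ m a b}"] by (auto simp: g_def bij_betw_def f_inv_into_f)
  \<comment> \<open>Chosen from the set alone, the representative is the same for all vertices of an
    orbit.\<close>
  define rep where "rep K = (SOME u. u \<in> K)" for K :: "nat set"
  have rep_in: "rep (orb v) \<in> orb v" for v unfolding rep_def by (rule someI[of _ v]) simp
  have rep_eq: "orb (rep (orb v)) = orb v" for v by (rule orb_eq[OF rep_in])
  have rep_m: "rep (orb v) \<in> {1..m}" if "v \<in> {1..m}" for v by (rule orbE[OF that rep_in])
  \<comment> \<open>The signs of \<open>x0\<close> relative to the representative are 1 at the
    representative itself; this makes \<open>G\<close> undo \<open>F\<close>.\<close>
  define \<sigma> where "\<sigma> v = x0 v \<bullet> x0 (rep (orb v))" for v
  have \<sigma>_orb: "sgn_on (orb v) \<sigma>" if v: "v \<in> {1..m}" for v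
  proof -
    have "sgn_on (orb v) (\<lambda>w. x0 w \<bullet> x0 (rep (orb v)))"
      using S_both_signing[OF x0 rep_m[OF v]] unfolding rep_eq .
    moreover have "\<sigma> w = x0 w \<bullet> x0 (rep (orb v))" if "w \<in> orb v" for w
      using orb_eq[OF that] by (simp add: \<sigma>_def)
    ultimately show ?thesis by (auto simp: signing_def orbit2.left orbit2.right)
  qed
  have \<sigma>: "\<sigma> v \<in> {1, - 1}" "\<sigma> (mate a v) = edge_sign a v * \<sigma> v" "\<sigma> (mate b v) = edge_sign b v * \<sigma> v"
    if "v \<in> {1..m}" for v
    using \<sigma>_orb[OF that] orbit2.base[of v "mate a" "mate b"] unfolding signing_def by blast+
  have \<sigma>_rep: "\<sigma> (rep (orb v)) = 1" if "v \<in> {1..m}" for v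
    using S_both_norm[OF x0 rep_m[OF that]] by (simp add: \<sigma>_def rep_eq norm_eq_1)
  have x_eq: "x v = \<sigma> v *\<^sub>R x (rep (orb v))" if x: "x \<in> S_both" and v: "v \<in> {1..m}" for x v
  proof -
    have "sgn_on (orb (rep (orb v))) \<sigma>" "v \<in> orb (rep (orb v))" using \<sigma>_orb[OF v] by (simp_all add: rep_eq)
    then show ?thesis using signing_determines[OF x rep_m[OF v]] \<sigma>_rep[OF v] by blast
  qed
  \<comment> \<open>A line contains a ray, where \<open>x\<close> and \<open>x0\<close> have the
    same prescribed value; the common signs spread the agreement over the orbit.\<close>
  have x_line: "x v = x0 v" if x: "x \<in> S_both" and v: "v \<in> {1..m}" and line: "\<not> closed_orbit (orb v)" for x v
  proof -
    obtain w where w: "w \<in> orb v" "mate a w = w \<or> mate b w = w"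
      using line unfolding closed_orbit_def by blast
    have wm: "w \<in> {1..m}" by (rule orbE[OF v w(1)])
    then have "x w = x0 w"
      using w(2) S_both_ray[OF x, of w] S_both_ray[OF x0, of w] a.Ray_iff b.Ray_iff by metis
    then have "\<sigma> w *\<^sub>R x (rep (orb v)) = \<sigma> w *\<^sub>R x0 (rep (orb v))"
      using x_eq[OF x wm] x_eq[OF x0 wm] orb_eq[OF w(1)] by simp
    then have "x (rep (orb v)) = x0 (rep (orb v))" using \<sigma>(1)[OF wm] by auto
    then show ?thesis using x_eq[OF x v] x_eq[OF x0 v] by simp
  qed
  \<comment> \<open>\<open>F\<close> spreads one unit vector over each closed orbit by the signs of
    \<open>x0\<close>, while \<open>G\<close> reads the coordinates at the representatives. The
    bijection \<open>h\<close>, with inverse \<open>g\<close>, numbers the closed orbits.\<close>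
  define F where "F y = (\<lambda>v\<in>{1..m}. if closed_orbit (orb v) then \<sigma> v *\<^sub>R y (g (orb v)) else x0 v)"
    for y :: "nat \<Rightarrow> real ^ 3"
  define G where "G x = (\<lambda>c\<in>{..<circ m a b}. x (rep (h c)))" for x :: "nat \<Rightarrow> real ^ 3"
  have W_orb: "orb v \<in> W" if "v \<in> {1..m}" "closed_orbit (orb v)" for v
    using that by (simp add: W_def)
  have cont_F_top: "continuous_map (sphere_power {..<circ m a b}) (sphere_power {1..m}) F"
    unfolding sphere_power_def continuous_map_componentwise
  proof (intro conjI ballI)
    show "F ` topspace (product_topology (\<lambda>_. top_of_set sphere2) {..<circ m a b}) \<subseteq> extensional {1..m}"
      by (auto simp: F_def)
    fix v assume v: "v \<in> {1..m}"
    show "continuous_map (product_topology (\<lambda>_. top_of_set sphere2) {..<circ m a b})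
        (top_of_set sphere2) (\<lambda>y. F y v)"
    proof (cases "closed_orbit (orb v)")
      case True
      have "g (orb v) \<in> {..<circ m a b}" using g[OF W_orb[OF v True]] by simp
      from continuous_map_product_projection[OF this]
      have "continuous_map (product_topology (\<lambda>_. top_of_set sphere2) {..<circ m a b})
          (top_of_set sphere2) (\<lambda>y. \<sigma> v *\<^sub>R y (g (orb v)))"
        by (rule continuous_map_scale_sphere2[OF _ \<sigma>(1)[OF v]])
      then show ?thesis using v True by (simp add: F_def)
    next
      case False
      then show ?thesis using v S_both_norm[OF x0 v] by (simp add: F_def)
    qed
  qed
  have F_in: "F y \<in> S_both" if y: "y \<in> topspace (sphere_power {..<circ m a b})" for y
  proof -
    have top: "F y \<in> topspace (sphere_power {1..m})"
      using continuous_map_image_subset_topspace[OF cont_F_top] y by blast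
    have Fv: "F y v = (if closed_orbit (orb v) then \<sigma> v *\<^sub>R y (g (orb v)) else x0 v)" if "v \<in> {1..m}" for v
      using that by (simp add: F_def)
    have "F y (mate a v) = edge_sign a v *\<^sub>R F y v" if v: "v \<in> {1..m}" for v
    proof -
      have "orb (mate a v) = orb v" by (rule orb_eq) auto
      then show ?thesis
        using Fv[OF v] Fv[OF a.mate_in[OF v]] \<sigma>(2)[OF v] S_both_mate(1)[OF x0 v] by simp
    qed
    moreover have "F y (mate b v) = edge_sign b v *\<^sub>R F y v" if v: "v \<in> {1..m}" for v
    proof -
      have "orb (mate b v) = orb v" by (rule orb_eq) auto
      then show ?thesis
        using Fv[OF v] Fv[OF b.mate_in[OF v]] \<sigma>(3)[OF v] S_both_mate(2)[OF x0 v] by simp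
    qed
    moreover have "F y v = ray_value a v" if R: "Ray v \<in> strands a" for v
    proof -
      have v: "v \<in> {1..m}" "mate a v = v" using R a.Ray_iff by auto
      then have "\<not> closed_orbit (orb v)" unfolding closed_orbit_def using orbit2.base by blast
      then show ?thesis using Fv[OF v(1)] S_both_ray(1)[OF x0 R] by simp
    qed
    moreover have "F y v = ray_value b v" if R: "Ray v \<in> strands b" for v
    proof -
      have v: "v \<in> {1..m}" "mate b v = v" using R b.Ray_iff by auto
      then have "\<not> closed_orbit (orb v)" unfolding closed_orbit_def using orbit2.base by blast
      then show ?thesis using Fv[OF v(1)] S_both_ray(2)[OF x0 R] by simp
    qed
    ultimately have "F y \<in> S_space m a" "F y \<in> S_space m b"
      using top a.S_space_iff b.S_space_iff by blast+
    then show ?thesis by blast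
  qed
  have rep_h: "rep (h c) \<in> {1..m}" "orb (rep (h c)) = h c" "closed_orbit (h c)" "\<sigma> (rep (h c)) = 1"
    if c: "c < circ m a b" for c
  proof -
    obtain v where v: "v \<in> {1..m}" "h c = orb v" using hW[OF c] by (auto simp: W_def)
    show "rep (h c) \<in> {1..m}" "orb (rep (h c)) = h c" "\<sigma> (rep (h c)) = 1"
      using rep_m rep_eq \<sigma>_rep v by auto
    show "closed_orbit (h c)" using hW[OF c] by (simp add: W_def)
  qed
  have cont_F: "continuous_map (sphere_power {..<circ m a b}) (subtopology (sphere_power {1..m}) S_both) F"
    using cont_F_top F_in by (auto simp: continuous_map_in_subtopology)
  have cont_G: "continuous_map (subtopology (sphere_power {1..m}) S_both) (sphere_power {..<circ m a b}) G"
  proof (rule continuous_map_from_subtopology)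
    show "continuous_map (sphere_power {1..m}) (sphere_power {..<circ m a b}) G"
      unfolding sphere_power_def continuous_map_componentwise
    proof (intro conjI ballI)
      show "G ` topspace (product_topology (\<lambda>_. top_of_set sphere2) {1..m}) \<subseteq> extensional {..<circ m a b}"
        by (auto simp: G_def)
      fix c assume c: "c \<in> {..<circ m a b}"
      then have "rep (h c) \<in> {1..m}" using rep_h by simp
      from continuous_map_product_projection[OF this]
      show "continuous_map (product_topology (\<lambda>_. top_of_set sphere2) {1..m}) (top_of_set sphere2) (\<lambda>x. G x c)"
        using c by (simp add: G_def)
    qed
  qed
  have GF: "G (F y) = y" if y: "y \<in> topspace (sphere_power {..<circ m a b})" for y
  proof (rule extensionalityI[of _ "{..<circ m a b}"])
    show "G (F y) \<in> extensional {..<circ m a b}" by (simp add: G_def)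
    show "y \<in> extensional {..<circ m a b}" using y by (simp add: sphere_power_def PiE_iff)
    fix c assume "c \<in> {..<circ m a b}"
    then show "G (F y) c = y c" using rep_h[of c] gh[of c] by (simp add: G_def F_def)
  qed
  have FG: "F (G x) = x" if x: "x \<in> S_both" for x
  proof (rule extensionalityI[of _ "{1..m}"])
    show "F (G x) \<in> extensional {1..m}" by (simp add: F_def)
    have "x \<in> topspace (sphere_power {1..m})" using x a.S_space_iff by blast
    then show "x \<in> extensional {1..m}" by (simp add: sphere_power_def PiE_iff)
    fix v assume v: "v \<in> {1..m}"
    show "F (G x) v = x v"
    proof (cases "closed_orbit (orb v)")
      case True
      then show ?thesis using g[OF W_orb[OF v True]] x_eq[OF x v] v by (simp add: F_def G_def)
    next
      case False
      then show ?thesis using x_line[OF x v False] v by (simp add: F_def)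
    qed
  qed
  have "homeomorphic_maps (subtopology (sphere_power {1..m}) S_both) (sphere_power {..<circ m a b}) G F"
    unfolding homeomorphic_maps_def using cont_F cont_G FG GF by (simp add: topspace_subtopology)
  then show ?thesis unfolding homeomorphic_space_def by blast
qed

end

theorem proposition27:
  fixes n m k :: nat and a b :: diagram
  assumes "n = 2 * m" and "1 \<le> k" and "k \<le> m" and "k = m \<or> odd k"
    and "a \<in> cup_diagrams (n - k) k" and "b \<in> cup_diagrams (n - k) k"
  shows "(S_space m a \<inter> S_space m b \<noteq> {} \<longleftrightarrow>
            (\<forall>C\<in>components (circle_diagram m a b). even (num_dots m a b C)) \<and>
            (\<forall>C\<in>components (circle_diagram m a b).
               \<not> closed_component m C \<longrightarrow> propagating m a b C)) \<and>
         (S_space m a \<inter> S_space m b \<noteq> {} \<longrightarrow>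
            subtopology (sphere_power {1..m}) (S_space m a \<inter> S_space m b)
              homeomorphic_space sphere_power {..<circ m a b})"
proof -
  \<comment> \<open>Because \<open>k \<le> m\<close>, the truncated subtraction \<open>n - k\<close>
    is exact, and both diagrams live on \<open>m\<close> vertices.\<close>
  have "(n - k + k) div 2 = m" using assms(1,3) by simp
  then have "cup_diagram m a" "cup_diagram m b" using assms(5,6) by (simp_all add: cup_diagrams_def)
  then interpret circle_pair m a b by unfold_locales
  show ?thesis using existence_iff S_both_homeomorphic by blast
qed

end
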